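(* Let $\mathcal{A}\in\mathbb{H}^{I_{1}\times \cdots \times I_{N}\times J_{1}\times \cdots \times J_{N}}$ and let $r=\operatorname{rank}(f(\mathcal{A}))$. Then there exist unitary tensors $\mathcal{U}\in\mathbb{H}^{I_{1}\times \cdots \times I_{N}\times I_{1}\times \cdots \times I_{N}}$ and $\mathcal{V}\in\mathbb{H}^{J_{1}\times \cdots \times J_{N}\times J_{1}\times \cdots \times J_{N}}$ such that $$\mathcal{A}=\mathcal{U}*_{N}\mathcal{B}*_{N}\mathcal{V}^{*},$$ where the real tensor $\mathcal{B}\in\mathbb{R}^{I_{1}\times \cdots \times I_{N}\times J_{1}\times \cdots \times J_{N}}$ has the structure $$\mathcal{B}_{i_{1}\cdots i_{N}j_{1}\cdots j_{N}}=\begin{cases} d_{i}, & \text{if } (i_{1},\ldots,i_{N},j_{1},\ldots,j_{N})=(p_{1}^{i},\ldots,p_{N}^{i},q_{1}^{i},\ldots,q_{N}^{i}) \text{ for some } i\in\{1,\ldots,r\},\\ 0, & \text{otherwise,}\end{cases}$$ $d_{1},\ldots,d_{r}$ are the positive singular values of the quaternion matrix $f(\mathcal{A})$, and the indices are determined recursively, for $i=1,\ldots,r$, by $$p_{t}^{i}=\left[\frac{i-1-\sum_{k=t+1}^{N}(p_{k}^{i}-1)\prod_{s=1}^{k-1}I_{s}}{\prod_{s=1}^{t-1}I_{s}}\right]+1\quad (t=N,N-1,\ldots,2),\qquad p_{1}^{i}=i-\sum_{k=2}^{N}(p_{k}^{i}-1)\prod_{s=1}^{k-1}I_{s},$$ $$q_{t}^{i}=\left[\frac{i-1-\sum_{k=t+1}^{N}(q_{k}^{i}-1)\prod_{s=1}^{k-1}J_{s}}{\prod_{s=1}^{t-1}J_{s}}\right]+1\quad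 (t=N,N-1,\ldots,2),\qquad q_{1}^{i}=i-\sum_{k=2}^{N}(q_{k}^{i}-1)\prod_{s=1}^{k-1}J_{s},$$ where $[a]$ denotes the largest integer less than or equal to the real number $a$ (for $t=N$ the sum in the numerator is empty).
   Context: $\mathbb{H}$ is the real quaternion algebra $\{q_0+q_1\mathbf{i}+q_2\mathbf{j}+q_3\mathbf{k}: q_0,\ldots,q_3\in\mathbb{R}\}$ with $\mathbf{i}^2=\mathbf{j}^2=\mathbf{k}^2=\mathbf{ijk}=-1$, and $\bar q=q_0-q_1\mathbf{i}-q_2\mathbf{j}-q_3\mathbf{k}$. $\mathbb{H}^{I_1\times\cdots\times I_N}$ (resp. $\mathbb{R}^{I_1\times\cdots\times I_N}$) is the set of order $N$ arrays $(a_{i_1\cdots i_N})_{1\le i_j\le I_j}$ with quaternion (resp. real) entries. Einstein product: for $\mathcal{A}\in\mathbb{H}^{I_{1}\times \cdots \times I_{N}\times J_{1}\times \cdots \times J_{N}}$ and $\mathcal{B}\in\mathbb{H}^{J_{1}\times \cdots \times J_{N}\times K_{1}\times \cdots \times K_{M}}$, $\mathcal{A}*_N\mathcal{B}\in\mathbb{H}^{I_{1}\times \cdots \times I_{N}\times K_{1}\times \cdots \times K_{M}}$ is given by $(\mathcal{A}*_{N}\mathcal{B})_{i_{1}\cdots i_{N}k_{1}\cdots k_{M}}=\sum_{j_{1}\cdots j_{N}}a_{i_{1}\cdots i_{N}j_{1}\cdots j_{N}}b_{j_{1}\cdots j_{N}k_{1}\cdots k_{M}}$. Conjugate transpose: for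 $\mathcal{A}\in\mathbb{H}^{I_{1}\times \cdots \times I_{N}\times J_{1}\times \cdots \times J_{N}}$, $\mathcal{A}^*\in\mathbb{H}^{J_{1}\times \cdots \times J_{N}\times I_{1}\times \cdots \times I_{N}}$ has entries $(\mathcal{A}^* )_{j_1\cdots j_Ni_1\cdots i_N}=\overline{a_{i_1\cdots i_Nj_1\cdots j_N}}$. The unit tensor $\mathcal{I}\in\mathbb{H}^{I_1\times\cdots\times I_N\times I_1\times\cdots\times I_N}$ has entry $1$ at positions $(i_1,\ldots,i_N,i_1,\ldots,i_N)$ and $0$ elsewhere. A tensor $\mathcal{U}\in\mathbb{H}^{I_{1}\times \cdots \times I_{N}\times I_{1}\times \cdots \times I_{N}}$ is unitary if $\mathcal{U}*_N\mathcal{U}^*=\mathcal{U}^**_N\mathcal{U}=\mathcal{I}$. Transformation $f$: for $\mathcal{A}\in\mathbb{H}^{I_{1}\times \cdots \times I_{N}\times J_{1}\times \cdots \times J_{N}}$, $f(\mathcal{A})$ is the quaternion matrix of size $(I_1\cdots I_N)\times(J_1\cdots J_N)$ whose entry in row $i_{1}+\sum_{k=2}^{N}(i_{k}-1)\prod_{s=1}^{k-1}I_{s}$ and column $j_{1}+\sum_{k=2}^{N}(j_{k}-1)\prod_{s=1}^{k-1}J_{s}$ is $a_{i_1\cdots i_Nj_1\cdots j_N}$. The positive singular values of a quaternion matrix $A$ of rank $r$ are the positive reals $d_1,\ldots,d_r$ (with multiplicity) in a decomposition $A=U\begin{pmatrix}D_r&0\\0&0\end{pmatrix}V^*$ with $U,V$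 unitary quaternion matrices and $D_r=\mathrm{diag}(d_1,\ldots,d_r)$. *)

theory Defs
  imports "HOL-Library.FuncSet" "Jordan_Normal_Form.Matrix"
begin

section \<open>The real quaternion algebra\<close>

datatype quat = Quat (qre: real) (qim1: real) (qim2: real) (qim3: real)

instantiation quat :: real_algebra_1
begin

definition "0 = Quat 0 0 0 0"
definition "1 = Quat 1 0 0 0"
definition "p + q = Quat (qre p + qre q) (qim1 p + qim1 q) (qim2 p + qim2 q) (qim3 p + qim3 q)"
definition "p - q = Quat (qre p - qre q) (qim1 p - qim1 q) (qim2 p - qim2 q) (qim3 p - qim3 q)"
definition "- q = Quat (- qre q) (- qim1 q) (- qim2 q) (- qim3 q)"
definition "scaleR c q = Quat (c * qre q) (c * qim1 q) (c * qim2 q) (c * qim3 q)"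
definition "p * q = Quat
  (qre p * qre q - qim1 p * qim1 q - qim2 p * qim2 q - qim3 p * qim3 q)
  (qre p * qim1 q + qim1 p * qre q + qim2 p * qim3 q - qim3 p * qim2 q)
  (qre p * qim2 q - qim1 p * qim3 q + qim2 p * qre q + qim3 p * qim1 q)
  (qre p * qim3 q + qim1 p * qim2 q - qim2 p * qim1 q + qim3 p * qre q)"

lemmas quat_arith_defs = zero_quat_def one_quat_def plus_quat_def minus_quat_def
  uminus_quat_def scaleR_quat_def times_quat_def

instance
  by standard (auto simp: quat_arith_defs algebra_simps quat.expand)

end

definition quat_i :: quat where "quat_i = Quat 0 1 0 0"
definition quat_j :: quat where "quat_j = Quat 0 0 1 0"
definition quat_k :: quat where "quat_k = Quat 0 0 0 1"

lemma quat_relations: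
  "quat_i * quat_i = -1" "quat_j * quat_j = -1" "quat_k * quat_k = -1"
  "quat_i * quat_j * quat_k = -1"
  by (simp_all add: quat_i_def quat_j_def quat_k_def quat_arith_defs)

lemma of_real_quat: "of_real c = Quat c 0 0 0"
  by (simp add: of_real_def quat_arith_defs)

lemma quat_eq_combination:
  "q = of_real (qre q) + of_real (qim1 q) * quat_i + of_real (qim2 q) * quat_j
     + of_real (qim3 q) * quat_k"
  by (cases q) (simp add: of_real_quat quat_i_def quat_j_def quat_k_def quat_arith_defs)

definition qcnj :: "quat \<Rightarrow> quat" where
  "qcnj q = Quat (qre q) (- qim1 q) (- qim2 q) (- qim3 q)"

section \<open>Quaternion matrices\<close>

text \<open>The adjoint of the matrix library requires a multiplicative conjugation, whereas
  quaternion conjugation reverses products.\<close>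

definition mat_ctranspose :: "quat mat \<Rightarrow> quat mat" where
  "mat_ctranspose A = map_mat qcnj (transpose_mat A)"

definition unitary_quat_mat :: "nat \<Rightarrow> quat mat \<Rightarrow> bool" where
  "unitary_quat_mat n U \<longleftrightarrow> U \<in> carrier_mat n n \<and>
     U * mat_ctranspose U = 1\<^sub>m n \<and> mat_ctranspose U * U = 1\<^sub>m n"

text \<open>The rank of a quaternion matrix is the maximal number of right linearly independent
  columns (scalars multiply columns from the right).\<close>

definition right_indep_cols :: "quat mat \<Rightarrow> nat set \<Rightarrow> bool" where
  "right_indep_cols A S \<longleftrightarrow>
     (\<forall>c :: nat \<Rightarrow> quat.
        (\<forall>i < dim_row A. (\<Sum>j\<in>S. A $$ (i, j) * c j) = 0) \<longrightarrow> (\<forall>j\<in>S. c j = 0))"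

definition quat_rank :: "quat mat \<Rightarrow> nat" where
  "quat_rank A = Max (card ` {S. S \<subseteq> {..<dim_col A} \<and> right_indep_cols A S})"

text \<open>The list \<open>ds\<close> enumerates the positive singular values with multiplicity; as in the
  decomposition itself, no particular order is required.\<close>

definition positive_singular_values :: "quat mat \<Rightarrow> real list \<Rightarrow> bool" where
  "positive_singular_values A ds \<longleftrightarrow>
     length ds = quat_rank A \<and> (\<forall>d\<in>set ds. 0 < d) \<and>
     (\<exists>U V. unitary_quat_mat (dim_row A) U \<and> unitary_quat_mat (dim_col A) V \<and>
        A = U * mat (dim_row A) (dim_col A)
                  (\<lambda>(i, j). if i = j \<and> i < length ds then of_real (ds ! i) else 0)
              * mat_ctranspose V)"

section \<open>Tensors\<close>

text \<open>Components of multi-indices and of dimension lists are counted from 1.\<close>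

abbreviation nth1 :: "'a list \<Rightarrow> nat \<Rightarrow> 'a" (infixl "!\<^sub>1" 100) where
  "xs !\<^sub>1 k \<equiv> xs ! (k - 1)"

definition indices :: "nat list \<Rightarrow> nat list set" where
  "indices ds = {ix. length ix = length ds \<and> (\<forall>k\<in>{1..length ds}. ix !\<^sub>1 k \<in> {1..ds !\<^sub>1 k})}"

text \<open>A tensor is its list of dimensions together with its entries; the entry function is
  fixed outside the index range, so that tensors are equal iff their dimensions and entries
  agree.\<close>

typedef 'a tensor = "{(ds :: nat list, f :: nat list \<Rightarrow> 'a). f \<in> extensional (indices ds)}"
  by (rule exI[of _ "([], \<lambda>_. undefined)"]) (simp add: extensional_def)

definition dims :: "'a tensor \<Rightarrow> nat list" where
  "dims A = fst (Rep_tensor A)"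

definition entry :: "'a tensor \<Rightarrow> nat list \<Rightarrow> 'a" (infixl "$\<^sub>t" 100) where
  "A $\<^sub>t ix = snd (Rep_tensor A) ix"

definition tensor :: "nat list \<Rightarrow> (nat list \<Rightarrow> 'a) \<Rightarrow> 'a tensor" where
  "tensor ds f = Abs_tensor (ds, restrict f (indices ds))"

lemma dims_tensor [simp]: "dims (tensor ds f) = ds"
  by (simp add: dims_def tensor_def Abs_tensor_inverse)

lemma entry_tensor [simp]: "ix \<in> indices ds \<Longrightarrow> tensor ds f $\<^sub>t ix = f ix"
  by (simp add: entry_def tensor_def Abs_tensor_inverse)

lemma tensor_eqI:
  assumes "dims A = dims B" "\<And>ix. ix \<in> indices (dims B) \<Longrightarrow> A $\<^sub>t ix = B $\<^sub>t ix"
  shows "A = B"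
proof -
  obtain a f where A: "Rep_tensor A = (a, f)" by (cases "Rep_tensor A")
  obtain b g where B: "Rep_tensor B = (b, g)" by (cases "Rep_tensor B")
  have "f \<in> extensional (indices a)" "g \<in> extensional (indices b)"
    using Rep_tensor[of A] Rep_tensor[of B] A B by auto
  then have "(a, f) = (b, g)"
    using assms A B by (auto simp: dims_def entry_def intro: extensionalityI)
  then show ?thesis
    using A B Rep_tensor_inject by metis
qed

definition map_tensor :: "('a \<Rightarrow> 'b) \<Rightarrow> 'a tensor \<Rightarrow> 'b tensor" where
  "map_tensor h A = tensor (dims A) (\<lambda>ix. h (A $\<^sub>t ix))"

text \<open>The Einstein product contracts the indices of \<open>A\<close> after the first \<open>N\<close> with the first \<open>N\<close>
  indices of \<open>B\<close>; it is meant for \<open>A\<close> of order \<open>2 * N\<close> and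
  \<open>drop N (dims A) = take N (dims B)\<close>.\<close>

definition einstein_prod :: "quat tensor \<Rightarrow> nat \<Rightarrow> quat tensor \<Rightarrow> quat tensor"
    ("(_ *\<^bsub>_\<^esub>/ _)" [70, 0, 71] 70) where
  "A *\<^bsub>N\<^esub> B = tensor (take N (dims A) @ drop N (dims B))
     (\<lambda>ix. \<Sum>js\<in>indices (take N (dims B)). A $\<^sub>t (take N ix @ js) * B $\<^sub>t (js @ drop N ix))"

text \<open>For \<open>A\<close> of order \<open>2 * N\<close>, where \<open>take N\<close> and \<open>drop N\<close> separate the two halves of an
  index.\<close>

definition ctranspose :: "nat \<Rightarrow> quat tensor \<Rightarrow> quat tensor" where
  "ctranspose N A = tensor (drop N (dims A) @ take N (dims A))
     (\<lambda>ix. qcnj (A $\<^sub>t (drop N ix @ take N ix)))"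

definition unit_tensor :: "nat list \<Rightarrow> quat tensor" where
  "unit_tensor Is = tensor (Is @ Is)
     (\<lambda>ix. if take (length Is) ix = drop (length Is) ix then 1 else 0)"

definition unitary_tensor :: "nat list \<Rightarrow> quat tensor \<Rightarrow> bool" where
  "unitary_tensor Is U \<longleftrightarrow> dims U = Is @ Is \<and>
     U *\<^bsub>length Is\<^esub> ctranspose (length Is) U = unit_tensor Is \<and>
     ctranspose (length Is) U *\<^bsub>length Is\<^esub> U = unit_tensor Is"

section \<open>The matrix of a tensor\<close>

definition linear_index :: "nat list \<Rightarrow> nat list \<Rightarrow> nat" where
  "linear_index ds ix =
     ix !\<^sub>1 1 + (\<Sum>k\<in>{2..length ds}. (ix !\<^sub>1 k - 1) * (\<Prod>s\<in>{1..k-1}. ds !\<^sub>1 s))"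

text \<open>\<open>linear_index ds\<close> is a bijection from the multi-indices onto \<open>{1..prod_list ds}\<close>, and
  library matrices count rows and columns from 0; see \<open>unfold_matrix_entry\<close> below.\<close>

definition unfold_matrix :: "nat \<Rightarrow> 'a tensor \<Rightarrow> 'a mat" where
  "unfold_matrix N A =
     (let Is = take N (dims A); Js = drop N (dims A)
      in mat (prod_list Is) (prod_list Js)
           (\<lambda>(a, b). A $\<^sub>t (inv_into (indices Is) (linear_index Is) (Suc a) @
                          inv_into (indices Js) (linear_index Js) (Suc b))))"

lemma indices_append_iff:
  "length is = length Is \<Longrightarrow> is @ js \<in> indices (Is @ Js) \<longleftrightarrow> is \<in> indices Is \<and> js \<in> indices Js"
proof -
  have ind: "ix \<in> indices ds \<longleftrightarrow> list_all2 (\<lambda>i d. i \<in> {1..d}) ix ds" for ix ds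
  proof -
    have "(\<forall>k\<in>{1..length ds}. ix !\<^sub>1 k \<in> {1..ds !\<^sub>1 k}) \<longleftrightarrow> (\<forall>k<length ds. ix ! k \<in> {1..ds ! k})"
      by (metis One_nat_def Suc_le_eq Suc_pred atLeastAtMost_iff diff_Suc_1 le_simps(1)
          less_Suc_eq_le zero_less_Suc)
    then show ?thesis
      by (auto simp: indices_def list_all2_conv_all_nth)
  qed
  assume "length is = length Is"
  then show ?thesis
    by (auto simp: ind list_all2_append)
qed

lemma linear_index_snoc:
  assumes "length ix = length ds" "ds \<noteq> []"
  shows "linear_index (ds @ [d]) (ix @ [i]) = linear_index ds ix + (i - 1) * prod_list ds"
proof -
  have eq: "{2..Suc (length ds)} = insert (Suc (length ds)) {2..length ds}"
    using assms(2) by (cases ds) auto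
  have P: "(\<Prod>s\<in>{1..length ds}. ds ! (s - 1)) = prod_list ds"
    by (metis (no_types, lifting) One_nat_def prod.atLeast_Suc_atMost_Suc_shift
        atLeast0LessThan atLeastLessThanSuc_atLeastAtMost comp_apply diff_Suc_1
        prod.atLeast1_atMost_eq prod.cong prod.list_conv_set_nth)
  have "(\<Sum>k\<in>{2..length ds}. ((ix @ [i]) !\<^sub>1 k - 1) * (\<Prod>s\<in>{1..k-1}. (ds @ [d]) !\<^sub>1 s)) =
        (\<Sum>k\<in>{2..length ds}. (ix !\<^sub>1 k - 1) * (\<Prod>s\<in>{1..k-1}. ds !\<^sub>1 s))"
    using assms by (intro sum.cong arg_cong2[where f = "(*)"] prod.cong) (auto simp: nth_append)
  moreover have "(\<Prod>s\<in>{1..length ds}. (ds @ [d]) !\<^sub>1 s) = prod_list ds"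
    unfolding P[symmetric] by (intro prod.cong) (auto simp: nth_append)
  ultimately show ?thesis
    using assms by (simp add: linear_index_def eq nth_append)
qed

lemma linear_index_bij:
  assumes "ds \<noteq> []"
  shows "bij_betw (linear_index ds) (indices ds) {1..prod_list ds}"
  using assms
proof (induction ds rule: rev_nonempty_induct)
  case (single d)
  have "indices [d] = (\<lambda>i. [i]) ` {1..d}"
    by (auto simp: indices_def length_Suc_conv)
  then show ?case
    by (auto simp: bij_betw_def inj_on_def linear_index_def image_iff)
next
  case (snoc d ds)
  let ?P = "prod_list ds"
  have len: "length ix = length ds" if "ix \<in> indices ds" for ix
    using that by (simp add: indices_def)
  have ind: "indices (ds @ [d]) = (\<lambda>(ix, i). ix @ [i]) ` (indices ds \<times> {1..d})"
  proof (intro subset_antisym subsetI)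
    fix x assume x: "x \<in> indices (ds @ [d])"
    then have "length x = Suc (length ds)" by (simp add: indices_def)
    then obtain ix i where "x = ix @ [i]" "length ix = length ds"
      by (metis length_Suc_conv_rev)
    with x show "x \<in> (\<lambda>(ix, i). ix @ [i]) ` (indices ds \<times> {1..d})"
      by (auto simp: indices_append_iff) (auto simp: indices_def)
  next
    fix x assume "x \<in> (\<lambda>(ix, i). ix @ [i]) ` (indices ds \<times> {1..d})"
    then show "x \<in> indices (ds @ [d])"
      by (auto simp: indices_append_iff len) (auto simp: indices_def)
  qed
  have b: "bij_betw (\<lambda>(ix, i). ix @ [i]) (indices ds \<times> {1..d}) (indices (ds @ [d]))"
    unfolding ind by (rule inj_on_imp_bij_betw) (auto simp: inj_on_def)
  have m: "bij_betw (map_prod (linear_index ds) id) (indices ds \<times> {1..d}) ({1..?P} \<times> {1..d})"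
    by (rule bij_betw_map_prod[OF snoc.IH]) simp
  have h: "bij_betw (\<lambda>(a, i). a + (i - 1) * ?P) ({1..?P} \<times> {1..d}) {1..?P * d}"
  proof (rule bij_betw_byWitness[where f' = "\<lambda>n. ((n - 1) mod ?P + 1, (n - 1) div ?P + 1)"])
    show "\<forall>x\<in>{1..?P} \<times> {1..d}.
      (\<lambda>n. ((n - 1) mod ?P + 1, (n - 1) div ?P + 1)) ((\<lambda>(a, i). a + (i - 1) * ?P) x) = x"
    proof
      fix x assume "x \<in> {1..?P} \<times> {1..d}"
      then obtain a i where "x = (Suc a, Suc i)" "a < ?P"
        by (cases x; cases "fst x"; cases "snd x") auto
      then show "(\<lambda>n. ((n - 1) mod ?P + 1, (n - 1) div ?P + 1)) ((\<lambda>(a, i). a + (i - 1) * ?P) x) = x"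
        by simp
    qed
    show "\<forall>n\<in>{1..?P * d}. (\<lambda>(a, i). a + (i - 1) * ?P) ((n - 1) mod ?P + 1, (n - 1) div ?P + 1) = n"
      by (auto simp: algebra_simps)
    show "(\<lambda>(a, i). a + (i - 1) * ?P) ` ({1..?P} \<times> {1..d}) \<subseteq> {1..?P * d}"
    proof clarify
      fix a i assume *: "a \<in> {1..?P}" "i \<in> {1..d}"
      then obtain i' where "i = Suc i'" "Suc i' \<le> d" by (cases i) auto
      then have "?P + i' * ?P \<le> ?P * d"
        using mult_le_mono2[of "Suc i'" d ?P] by (simp add: algebra_simps)
      with * \<open>i = Suc i'\<close> show "a + (i - 1) * ?P \<in> {1..?P * d}" by auto
    qed
    show "(\<lambda>n. ((n - 1) mod ?P + 1, (n - 1) div ?P + 1)) ` {1..?P * d} \<subseteq> {1..?P} \<times> {1..d}"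
    proof clarify
      fix n assume n: "n \<in> {1..?P * d}"
      then have P: "0 < ?P" by (cases ?P) auto
      have "n - 1 < ?P * d" using n by auto
      then have "(n - 1) div ?P < d" by (simp add: less_mult_imp_div_less mult.commute)
      moreover have "(n - 1) mod ?P < ?P" using P by simp
      ultimately show "(n - 1) mod ?P + 1 \<in> {1..?P} \<and> (n - 1) div ?P + 1 \<in> {1..d}" by auto
    qed
  qed
  have "bij_betw ((\<lambda>(a, i). a + (i - 1) * ?P) \<circ> map_prod (linear_index ds) id)
      (indices ds \<times> {1..d}) {1..?P * d}"
    by (rule bij_betw_trans[OF m h])
  also have "?this \<longleftrightarrow> bij_betw (linear_index (ds @ [d]) \<circ> (\<lambda>(ix, i). ix @ [i]))
      (indices ds \<times> {1..d}) {1..?P * d}"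
    using snoc.hyps by (intro bij_betw_cong) (auto simp: linear_index_snoc len)
  finally show ?case
    by (simp only: bij_betw_comp_iff[OF b, symmetric] prod_list.append prod_list.Cons
        prod_list.Nil mult_1_right)
qed

lemma unfold_matrix_entry:
  assumes "dims A = Is @ Js" "length Is = N" "Is \<noteq> []" "Js \<noteq> []"
    and "is \<in> indices Is" "js \<in> indices Js"
  shows "unfold_matrix N A $$ (linear_index Is is - 1, linear_index Js js - 1) = A $\<^sub>t (is @ js)"
proof -
  have "linear_index Is is \<in> {1..prod_list Is}" "linear_index Js js \<in> {1..prod_list Js}"
    using bij_betwE[OF linear_index_bij] assms(3-6) by blast+
  then obtain a b where "linear_index Is is = Suc a" "a < prod_list Is"
    "linear_index Js js = Suc b" "b < prod_list Js"
    by (cases "linear_index Is is"; cases "linear_index Js js") auto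
  moreover have "inv_into (indices Is) (linear_index Is) (linear_index Is is) = is"
    "inv_into (indices Js) (linear_index Js) (linear_index Js js) = js"
    using linear_index_bij assms by (auto simp: bij_betw_def)
  ultimately show ?thesis
    using assms by (simp add: unfold_matrix_def)
qed

section \<open>The positions of the singular values\<close>

text \<open>\<open>pos_index ds i t\<close> is the \<open>t\<close>-th component of the multi-index carrying the \<open>i\<close>-th singular
  value: \<open>p\<^sub>t\<^sup>i\<close> for the dimensions \<open>I\<close> and \<open>q\<^sub>t\<^sup>i\<close> for the dimensions \<open>J\<close>.
  The index recursion runs downwards from \<open>t = length ds\<close> to \<open>t = 1\<close>; it is stated over the
  integers so that no subtraction is truncated.\<close>

function pos_index :: "nat list \<Rightarrow> nat \<Rightarrow> nat \<Rightarrow> int" where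
  "pos_index ds i t =
     (if t = 1
      then int i - (\<Sum>k\<in>{2..length ds}. (pos_index ds i k - 1) * int (\<Prod>s\<in>{1..k-1}. ds !\<^sub>1 s))
      else \<lfloor>real_of_int (int i - 1 -
                (\<Sum>k\<in>{t+1..length ds}. (pos_index ds i k - 1) * int (\<Prod>s\<in>{1..k-1}. ds !\<^sub>1 s)))
             / real (\<Prod>s\<in>{1..t-1}. ds !\<^sub>1 s)\<rfloor> + 1)"
  by pat_completeness auto
termination
  by (relation "measure (\<lambda>(ds, i, t). length ds - t)") auto

declare pos_index.simps [simp del]

definition at_position :: "nat list \<Rightarrow> nat \<Rightarrow> nat list \<Rightarrow> bool" where
  "at_position ds i ix \<longleftrightarrow> map int ix = map (pos_index ds i) [1..<length ds + 1]"

end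

theory Submission
  imports Defs "HOL-Analysis.Product_Topology" "HOL-Analysis.Topology_Euclidean_Space"
begin

text \<open>The map \<open>f\<close> turns the Einstein product into the matrix product, the conjugate transpose of
  tensors into that of matrices and the unit tensor into the identity, so the theorem is the
  singular value decomposition of \<open>f(A)\<close> carried back to tensors; the recursion for \<open>p\<close> and \<open>q\<close>
  reads off the mixed-radix digits of \<open>i - 1\<close>, i.e. inverts the linear index.

  The decomposition of a quaternion matrix \<open>A\<close> is found greedily. Given orthonormal
  \<open>v\<^sub>1, \<dots>, v\<^sub>k\<close>, let \<open>w\<close> maximize \<open>|Aw|\<close> on the (compact) unit sphere of their orthogonal complement.
  The first variation of \<open>|A(w + x c)|\<^sup>2\<close> at \<open>c = 0\<close> shows that \<open>Aw\<close> is orthogonal to \<open>Ax\<close> whenever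
  \<open>x\<close> is orthogonal to \<open>v\<^sub>1, \<dots>, v\<^sub>k, w\<close>. Stopping once \<open>A\<close> vanishes on the complement, the \<open>v\<^sub>i\<close> and
  the normalized \<open>A v\<^sub>i\<close> extend to the two unitary matrices. All dimension counts, including the
  equality of the rank and the number of singular values, rest on the fact that a homogeneous
  linear system over a division ring with more unknowns than equations has a nonzero solution.\<close>

section \<open>Quaternions as a Euclidean space and a normed division algebra\<close>

text \<open>The form is the Euclidean one of R^4 and equals \<open>qre (qcnj p * q)\<close>; it
  supplies the norm and topology for the compactness argument below.\<close>

instantiation quat :: real_inner
begin

definition "inner p q = qre p * qre q + qim1 p * qim1 q + qim2 p * qim2 q + qim3 p * qim3 q"
  for p q :: quat
definition "norm q = sqrt (inner q q)" for q :: quat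
definition "sgn q = inverse (norm q) *\<^sub>R q" for q :: quat
definition "dist p q = norm (p - q)" for p q :: quat
definition "uniformity = (INF e\<in>{0<..}. principal {(p :: quat, q). dist p q < e})"
definition "open S \<longleftrightarrow> (\<forall>p\<in>S. eventually (\<lambda>(p', q). p' = p \<longrightarrow> q \<in> S) uniformity)"
  for S :: "quat set"

instance
proof
  fix p q s :: quat and c :: real and S :: "quat set"
  show "dist p q = norm (p - q)" by (rule dist_quat_def)
  show "sgn q = q /\<^sub>R norm q" by (simp add: sgn_quat_def)
  show "(uniformity :: (quat \<times> quat) filter) = (INF e\<in>{0<..}. principal {(x, y). dist x y < e})"
    by (rule uniformity_quat_def)
  show "open S \<longleftrightarrow> (\<forall>p\<in>S. eventually (\<lambda>(p', q). p' = p \<longrightarrow> q \<in> S) uniformity)"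
    by (rule open_quat_def)
  show "inner p q = inner q p" "inner (p + q) s = inner p s + inner q s"
    "inner (c *\<^sub>R p) q = c * inner p q"
    by (simp_all add: inner_quat_def quat_arith_defs algebra_simps)
  show "0 \<le> inner p p" by (simp add: inner_quat_def)
  show "inner p p = 0 \<longleftrightarrow> p = 0"
    by (cases p) (simp add: inner_quat_def quat_arith_defs add_nonneg_eq_0_iff)
  show "norm p = sqrt (inner p p)" by (rule norm_quat_def)
qed

end

lemma quat_sel_simps [simp]:
  "qre 0 = 0" "qim1 0 = 0" "qim2 0 = 0" "qim3 0 = 0"
  "qre 1 = 1" "qim1 1 = 0" "qim2 1 = 0" "qim3 1 = 0"
  "qre (p + q) = qre p + qre q" "qim1 (p + q) = qim1 p + qim1 q"
  "qim2 (p + q) = qim2 p + qim2 q" "qim3 (p + q) = qim3 p + qim3 q"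
  "qre (c *\<^sub>R q) = c * qre q"
  "qre (of_real c) = c"
  by (simp_all add: quat_arith_defs of_real_quat)

lemma norm_quat_square:
  "(norm q)\<^sup>2 = (qre q)\<^sup>2 + (qim1 q)\<^sup>2 + (qim2 q)\<^sup>2 + (qim3 q)\<^sup>2" for q :: quat
  by (simp add: norm_quat_def inner_quat_def power2_eq_square)

lemma qcnj_simps [simp]:
  "qcnj 0 = 0" "qcnj 1 = 1" "qcnj (p + q) = qcnj p + qcnj q" "qcnj (- q) = - qcnj q"
  "qcnj (p - q) = qcnj p - qcnj q" "qcnj (qcnj q) = q" "qcnj (of_real c) = of_real c"
  "qcnj (p * q) = qcnj q * qcnj p"
  by (simp_all add: qcnj_def quat_arith_defs of_real_quat)

lemma qcnj_sum [simp]: "qcnj (sum f S) = (\<Sum>x\<in>S. qcnj (f x))"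
  by (induction S rule: infinite_finite_induct) auto

lemma qre_sum [simp]: "qre (sum f S) = (\<Sum>x\<in>S. qre (f x))"
  by (induction S rule: infinite_finite_induct) auto

lemma norm_qcnj [simp]: "norm (qcnj q) = norm q"
  by (simp add: norm_quat_def inner_quat_def qcnj_def)

lemma qcnj_mult_self: "qcnj q * q = of_real ((norm q)\<^sup>2)" "q * qcnj q = of_real ((norm q)\<^sup>2)"
  by (simp_all add: norm_quat_square qcnj_def of_real_quat times_quat_def)
    (simp_all add: power2_eq_square)

instantiation quat :: real_normed_div_algebra
begin

definition "inverse q = qcnj q /\<^sub>R (norm q)\<^sup>2" for q :: quat
definition "p div q = p * inverse q" for p q :: quat

instance
proof
  fix p q :: quat
  show "p \<noteq> 0 \<Longrightarrow> inverse p * p = 1" "p \<noteq> 0 \<Longrightarrow> p * inverse p = 1"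
    by (simp_all add: inverse_quat_def qcnj_mult_self of_real_def del: of_real_power)
  show "p div q = p * inverse q" by (rule divide_quat_def)
  show "inverse (0 :: quat) = 0" by (simp add: inverse_quat_def)
  \<comment> \<open>Euler's four-square identity, checked on components.\<close>
  have "(norm (p * q))\<^sup>2 = (norm p * norm q)\<^sup>2"
    by (simp add: norm_quat_square power_mult_distrib times_quat_def)
      (simp add: power2_eq_square algebra_simps)
  then show "norm (p * q) = norm p * norm q"
    by (rule power2_eq_imp_eq) simp_all
qed

end

text \<open>Finite real dimension makes closed balls compact, on which the maximization of |Aw|
  relies.\<close>

instantiation quat :: euclidean_space
begin

definition "Basis = {1, quat_i, quat_j, quat_k}"

instance
  by standard
    (auto simp: Basis_quat_def inner_quat_def quat_i_def quat_j_def quat_k_def one_quat_def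
      zero_quat_def quat.expand)

end

section \<open>Quaternionic orthonormal systems\<close>

text \<open>Gaussian elimination by induction on the equations: a row with a nonzero pivot is solved
  for one unknown, which is then eliminated from the other rows, so both counts drop by one.
  Coefficients stand left of the unknowns, so rows are scaled from the left.\<close>

lemma homogeneous_system_nontrivial:
  fixes a :: "'i \<Rightarrow> 'j \<Rightarrow> 'a::division_ring"
  assumes "finite I" "finite J" "card I < card J"
  shows "\<exists>x. (\<exists>j\<in>J. x j \<noteq> 0) \<and> (\<forall>i\<in>I. (\<Sum>j\<in>J. a i j * x j) = 0)"
  using assms
proof (induction I arbitrary: J a rule: finite_induct)
  case empty
  then have "J \<noteq> {}" by auto
  then show ?case by (auto intro!: exI[of _ "\<lambda>_. 1"])
next
  case (insert k I)
  show ?case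
  proof (cases "\<forall>j\<in>J. a k j = 0")
    case True
    obtain x where "\<exists>j\<in>J. x j \<noteq> 0" "\<forall>i\<in>I. (\<Sum>j\<in>J. a i j * x j) = 0"
      using insert.IH[of J a] insert.prems insert.hyps by auto
    then show ?thesis using True by (intro exI[of _ x]) simp
  next
    case False
    then obtain l where l: "l \<in> J" "a k l \<noteq> 0" by blast
    let ?p = "a k l"
    \<comment> \<open>Row \<open>i\<close> minus \<open>a i l * inverse ?p\<close> times the pivot
      row; the coefficient at \<open>l\<close> becomes zero.\<close>
    define b where "b i j = a i j - a i l * inverse ?p * a k j" for i j
    have "card I < card (J - {l})" using insert.prems insert.hyps l by simp
    then obtain x where x: "\<exists>j\<in>J - {l}. x j \<noteq> 0"
      "\<forall>i\<in>I. (\<Sum>j\<in>J - {l}. b i j * x j) = 0"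
      using insert.IH[of "J - {l}" b] insert.prems by auto
    define s where "s = (\<Sum>j\<in>J - {l}. a k j * x j)"
    \<comment> \<open>The pivot equation forces this value at \<open>l\<close>.\<close>
    define y where "y = x(l := - (inverse ?p * s))"
    have split: "(\<Sum>j\<in>J. a i j * y j) = (\<Sum>j\<in>J - {l}. a i j * x j) - a i l * (inverse ?p * s)" for i
    proof -
      have "(\<Sum>j\<in>J - {l}. a i j * y j) = (\<Sum>j\<in>J - {l}. a i j * x j)"
        by (rule sum.cong) (auto simp: y_def)
      then show ?thesis
        using l insert.prems by (simp add: sum.remove[of J l] y_def)
    qed
    have "(\<Sum>j\<in>J. a i j * y j) = 0" if "i \<in> I" for i
    proof -
      have "0 = (\<Sum>j\<in>J - {l}. b i j * x j)" using x that by simp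
      also have "\<dots> = (\<Sum>j\<in>J - {l}. a i j * x j) - a i l * (inverse ?p * s)"
        by (simp add: b_def s_def left_diff_distrib sum_subtractf sum_distrib_left mult.assoc)
      finally show ?thesis by (simp add: split)
    qed
    moreover have "(\<Sum>j\<in>J. a k j * y j) = 0"
      using l by (simp add: split s_def flip: mult.assoc)
    moreover have "\<exists>j\<in>J. y j \<noteq> 0" using x by (auto simp: y_def)
    ultimately show ?thesis by blast
  qed
qed

text \<open>Scalars act on vectors from the right. A vector of dimension \<open>n\<close> is a function of which only
  the values below \<open>n\<close> matter, and \<open>v k\<close> is the \<open>k\<close>-th vector of a system \<open>v\<close>.\<close>

definition qdot :: "nat \<Rightarrow> (nat \<Rightarrow> quat) \<Rightarrow> (nat \<Rightarrow> quat) \<Rightarrow> quat" where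
  "qdot n x y = (\<Sum>i<n. qcnj (x i) * y i)"

definition sqnorm :: "nat \<Rightarrow> (nat \<Rightarrow> quat) \<Rightarrow> real" where
  "sqnorm n x = (\<Sum>i<n. (norm (x i))\<^sup>2)"

definition mat_app :: "nat \<Rightarrow> (nat \<Rightarrow> nat \<Rightarrow> quat) \<Rightarrow> (nat \<Rightarrow> quat) \<Rightarrow> nat \<Rightarrow> quat" where
  "mat_app n a x i = (\<Sum>j<n. a i j * x j)"

definition orthonormal :: "nat \<Rightarrow> nat \<Rightarrow> (nat \<Rightarrow> nat \<Rightarrow> quat) \<Rightarrow> bool" where
  "orthonormal n k v \<longleftrightarrow> (\<forall>i<k. \<forall>j<k. qdot n (v i) (v j) = (if i = j then 1 else 0))"

lemma qdot_self: "qdot n x x = of_real (sqnorm n x)"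
  by (simp add: qdot_def sqnorm_def qcnj_mult_self)

lemma qcnj_qdot [simp]: "qcnj (qdot n x y) = qdot n y x"
  by (simp add: qdot_def)

lemma qdot_eq_0_commute: "qdot n x y = 0 \<longleftrightarrow> qdot n y x = 0"
  by (metis qcnj_qdot qcnj_simps(1))

lemma qdot_linear:
  "qdot n x (\<lambda>i. y i + z i) = qdot n x y + qdot n x z"
  "qdot n x (\<lambda>i. y i - z i) = qdot n x y - qdot n x z"
  "qdot n x (\<lambda>i. y i * c) = qdot n x y * c"
  "qdot n x (\<lambda>i. \<Sum>k\<in>K. f k i) = (\<Sum>k\<in>K. qdot n x (f k))"
proof -
  show "qdot n x (\<lambda>i. \<Sum>k\<in>K. f k i) = (\<Sum>k\<in>K. qdot n x (f k))"
    unfolding qdot_def sum_distrib_left by (rule sum.swap)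
qed (simp_all add: qdot_def algebra_simps sum.distrib sum_subtractf sum_distrib_left sum_distrib_right)

lemma mat_app_linear:
  "mat_app n a (\<lambda>j. x j + y j) = (\<lambda>i. mat_app n a x i + mat_app n a y i)"
  "mat_app n a (\<lambda>j. x j * c) = (\<lambda>i. mat_app n a x i * c)"
  by (simp_all add: mat_app_def fun_eq_iff algebra_simps sum.distrib sum_distrib_right)

lemma sqnorm_nonneg [simp]: "0 \<le> sqnorm n x"
  by (simp add: sqnorm_def sum_nonneg)

lemma sqnorm_eq_0_iff: "sqnorm n x = 0 \<longleftrightarrow> (\<forall>i<n. x i = 0)"
  by (auto simp: sqnorm_def sum_nonneg_eq_0_iff)

lemma sqnorm_scale: "sqnorm n (\<lambda>i. x i * c) = sqnorm n x * (norm c)\<^sup>2"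
  by (simp add: sqnorm_def norm_mult power_mult_distrib sum_distrib_right)

lemma sqnorm_add: "sqnorm n (\<lambda>i. x i + y i) = sqnorm n x + 2 * qre (qdot n x y) + sqnorm n y"
proof -
  have "(norm (p + q))\<^sup>2 = (norm p)\<^sup>2 + 2 * qre (qcnj p * q) + (norm q)\<^sup>2" for p q :: quat
    by (simp add: norm_quat_square qcnj_def times_quat_def) (simp add: power2_eq_square algebra_simps)
  then show ?thesis
    by (simp add: sqnorm_def qdot_def sum.distrib sum_distrib_left)
qed

lemma sqnorm_normalize:
  assumes "sqnorm n x \<noteq> 0"
  shows "sqnorm n (\<lambda>i. x i * of_real (1 / sqrt (sqnorm n x))) = 1"
  using assms by (simp add: sqnorm_scale power_divide del: of_real_divide)

section \<open>Orthonormal systems: expansion, extension and completeness\<close>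

lemma orthonormal_qdot:
  "orthonormal n k v \<Longrightarrow> i < k \<Longrightarrow> j < k \<Longrightarrow> qdot n (v i) (v j) = (if i = j then 1 else 0)"
  by (simp add: orthonormal_def)

lemma orthonormal_qdot_combination:
  assumes "orthonormal n k v" "l < k"
  shows "qdot n (v l) (\<lambda>i. \<Sum>j<k. v j i * c j) = c l"
proof -
  have "qdot n (v l) (\<lambda>i. \<Sum>j<k. v j i * c j) = (\<Sum>j<k. (if l = j then 1 else 0) * c j)"
    using assms by (simp add: qdot_linear orthonormal_qdot)
  then show ?thesis using assms(2) by (simp add: if_distrib[of "\<lambda>x. x * _"] cong: if_cong)
qed

text \<open>If \<open>k > n\<close>, the vectors satisfy a nontrivial relation with coefficients on
  the right; pairing it with \<open>v l\<close> isolates \<open>x l\<close>, so all coefficients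
  vanish.\<close>

lemma orthonormal_le_dim:
  assumes "orthonormal n k v"
  shows "k \<le> n"
proof (rule ccontr)
  assume "\<not> k \<le> n"
  then obtain x where x: "\<exists>j\<in>{..<k}. x j \<noteq> 0" "\<forall>i\<in>{..<n}. (\<Sum>j<k. v j i * x j) = 0"
    using homogeneous_system_nontrivial[of "{..<n}" "{..<k}" "\<lambda>i j. v j i"] by auto
  have "x l = 0" if "l < k" for l
    using orthonormal_qdot_combination[OF assms that, of x] x(2) by (simp add: qdot_def)
  with x(1) show False by auto
qed

lemma orthonormal_snoc:
  assumes "orthonormal n k v" "\<And>i. i < k \<Longrightarrow> qdot n (v i) w = 0" "sqnorm n w = 1"
  shows "orthonormal n (Suc k) (v(k := w))"
proof -
  have "qdot n w (v i) = 0" if "i < k" for i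
    using assms(2)[OF that] by (simp add: qdot_eq_0_commute)
  then show ?thesis
    using assms by (auto simp: orthonormal_def less_Suc_eq qdot_self)
qed

lemma orthonormal_snoc_normalize:
  assumes "orthonormal n k v" "\<And>i. i < k \<Longrightarrow> qdot n (v i) w = 0" "\<exists>i<n. w i \<noteq> 0"
  shows "\<exists>c :: real. orthonormal n (Suc k) (v(k := \<lambda>i. w i * of_real c))"
proof -
  have "sqnorm n w \<noteq> 0" using assms(3) by (auto simp: sqnorm_eq_0_iff)
  from sqnorm_normalize[OF this] show ?thesis
    using assms
    by (intro exI[of _ "1 / sqrt (sqnorm n w)"] orthonormal_snoc)
      (simp_all add: qdot_linear del: of_real_divide)
qed

text \<open>Orthogonality to \<open>k\<close> vectors is a system of \<open>k\<close> equations in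
  \<open>n\<close> unknowns, whose nonzero solution is normalized.\<close>

lemma orthonormal_extend_one:
  assumes "orthonormal n k v" "k < n"
  shows "\<exists>w. orthonormal n (Suc k) (v(k := w))"
proof -
  obtain x where "\<exists>j\<in>{..<n}. x j \<noteq> 0" "\<forall>i\<in>{..<k}. (\<Sum>j<n. qcnj (v i j) * x j) = 0"
    using homogeneous_system_nontrivial[of "{..<k}" "{..<n}" "\<lambda>i j. qcnj (v i j)"] assms by auto
  then show ?thesis
    using orthonormal_snoc_normalize[OF assms(1), of x] by (auto simp: qdot_def)
qed

lemma orthonormal_extend:
  assumes "orthonormal n k v"
  shows "\<exists>v'. orthonormal n n v' \<and> (\<forall>i<k. v' i = v i)"
  using orthonormal_le_dim[OF assms] assms
proof (induction arbitrary: v rule: inc_induct)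
  case base
  then show ?case by blast
next
  case (step k)
  then obtain w where "orthonormal n (Suc k) (v(k := w))"
    using orthonormal_extend_one by blast
  from step.IH[OF this] show ?case by force
qed

text \<open>What remains of a standard unit vector after projection onto all \<open>v k\<close> is
  orthogonal to them, so it vanishes: otherwise there would be \<open>n + 1\<close> orthonormal
  vectors in dimension \<open>n\<close>. In matrix terms, the adjoint is a right inverse as well as
  a left inverse.\<close>

lemma orthonormal_basis_completeness:
  assumes "orthonormal n n v" "i < n" "j < n"
  shows "(\<Sum>k<n. v k i * qcnj (v k j)) = (if i = j then 1 else 0)"
proof -
  define e :: "nat \<Rightarrow> quat" where "e l = (if l = j then 1 else 0)" for l
  have e: "qdot n (v k) e = qcnj (v k j)" for k
    using assms(3) by (simp add: qdot_def e_def if_distrib cong: if_cong)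
  define w where "w l = e l - (\<Sum>k<n. v k l * qdot n (v k) e)" for l
  have "qdot n (v k) w = 0" if "k < n" for k
    unfolding w_def qdot_linear(2)
    using orthonormal_qdot_combination[OF assms(1) that, of "\<lambda>k. qdot n (v k) e"] by simp
  then have "\<not> (\<exists>l<n. w l \<noteq> 0)"
    using orthonormal_snoc_normalize[OF assms(1), of w] orthonormal_le_dim[of n "Suc n"] not_less_eq_eq
    by blast
  with assms(2) have "w i = 0" by blast
  then show ?thesis by (simp add: w_def e e_def)
qed

section \<open>Singular value decomposition\<close>

text \<open>The maximum is attained by compactness, and homogeneity of degree two carries the bound
  from unit vectors to all \<open>x\<close>. Vectors are functions on all naturals with free values
  from \<open>n\<close> on, so the sphere is first cut down to the box \<open>K\<close>, compact by
  Tychonoff's theorem.\<close>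

lemma exists_maximal_direction:
  assumes "orthonormal n k v" "k < n"
  shows "\<exists>w. sqnorm n w = 1 \<and> (\<forall>i<k. qdot n (v i) w = 0) \<and>
     (\<forall>x. (\<forall>i<k. qdot n (v i) x = 0) \<longrightarrow>
        sqnorm m (mat_app n a x) \<le> sqnorm m (mat_app n a w) * sqnorm n x)"
proof -
  define K :: "(nat \<Rightarrow> quat) set" where "K = (\<Pi>\<^sub>E i\<in>UNIV. cball 0 1)"
  define T where "T = {w. sqnorm n w = 1} \<inter> (\<Inter>i<k. {w. qdot n (v i) w = 0})"
  define f where "f w = sqnorm m (mat_app n a w)" for w
  have coord: "continuous_on S (\<lambda>w :: nat \<Rightarrow> quat. w j)" for S j
    by (rule continuous_on_subset[OF continuous_on_product_coordinates]) simp
  have "compact K"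
    unfolding K_def compactin_euclidean_iff[symmetric]
    by (subst euclidean_product_topology[symmetric], subst compactin_PiE) simp
  moreover have "closed T"
    unfolding T_def sqnorm_def qdot_def
    by (intro closed_Int closed_INT ballI closed_Collect_eq continuous_intros coord)
  ultimately have "compact (K \<inter> T)" by (rule compact_Int_closed)
  moreover have cont: "continuous_on (K \<inter> T) f"
    unfolding f_def sqnorm_def mat_app_def by (intro continuous_intros coord)
  \<comment> \<open>Zeroing the coordinates from \<open>n\<close> on moves a point of
    \<open>T\<close> into the box, because each coordinate of a unit vector has norm at most
    1.\<close>
  have trunc: "\<exists>y\<in>K \<inter> T. \<forall>j<n. y j = x j" if x: "x \<in> T" for x
  proof (rule bexI[of _ "\<lambda>j. if j < n then x j else 0"])
    have "(norm (x j))\<^sup>2 \<le> 1" if "j < n" for j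
      using x that member_le_sum[of j "{..<n}" "\<lambda>j. (norm (x j))\<^sup>2"] by (simp add: T_def sqnorm_def)
    then have "norm (x j) \<le> 1" if "j < n" for j
      using that by (simp add: power_le_one_iff)
    then show "(\<lambda>j. if j < n then x j else 0) \<in> K \<inter> T"
      using x by (auto simp: T_def K_def sqnorm_def qdot_def)
  qed simp
  have feq: "f x = f y" if "\<forall>j<n. y j = x j" for x y
    using that by (simp add: f_def mat_app_def[abs_def])
  obtain w0 where w0: "orthonormal n (Suc k) (v(k := w0))"
    using orthonormal_extend_one[OF assms] by blast
  have "sqnorm n w0 = 1"
    using orthonormal_qdot[OF w0, of k k] by (simp add: qdot_self)
  moreover have "qdot n (v i) w0 = 0" if "i < k" for i
    using orthonormal_qdot[OF w0, of i k] that by simp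
  ultimately have "w0 \<in> T" by (simp add: T_def)
  with trunc have "K \<inter> T \<noteq> {}" by blast
  with \<open>compact (K \<inter> T)\<close> cont obtain w where w: "w \<in> K \<inter> T" "\<And>y. y \<in> K \<inter> T \<Longrightarrow> f y \<le> f w"
    using continuous_attains_sup by metis
  have "f x \<le> f w * sqnorm n x" if x: "\<forall>i<k. qdot n (v i) x = 0" for x
  proof (cases "sqnorm n x = 0")
    case True
    then have "f x = 0" by (simp add: f_def mat_app_def sqnorm_eq_0_iff)
    with True show ?thesis by simp
  next
    case False
    let ?c = "1 / sqrt (sqnorm n x)"
    define y where "y i = x i * of_real ?c" for i
    have "y \<in> T"
      using x sqnorm_normalize[OF False] by (simp add: T_def y_def[abs_def] qdot_linear del: of_real_divide)
    then obtain z where "z \<in> K \<inter> T" "\<forall>j<n. z j = y j" using trunc by blast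
    then have "f y \<le> f w" using w(2) feq by metis
    moreover have "f y = f x * ?c\<^sup>2"
      unfolding f_def y_def[abs_def] mat_app_linear sqnorm_scale by (simp del: of_real_divide)
    moreover have "?c\<^sup>2 = 1 / sqnorm n x" by (simp add: power_divide)
    moreover have "sqnorm n x > 0" using False by (simp add: less_le)
    ultimately show ?thesis by (simp add: divide_le_eq)
  qed
  with w(1) show ?thesis unfolding f_def T_def by auto
qed

text \<open>The choice \<open>c = cnj p * t\<close> with \<open>p = (Aw, Ax)\<close> turns the first variation into \<open>2 t |p|\<^sup>2\<close>.\<close>

lemma maximal_direction_orthogonal:
  assumes "sqnorm n w = 1" and "qdot n w x = 0"
    and max: "\<And>c. sqnorm m (mat_app n a (\<lambda>i. w i + x i * c)) \<le>
      sqnorm m (mat_app n a w) * sqnorm n (\<lambda>i. w i + x i * c)"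
  shows "qdot m (mat_app n a w) (mat_app n a x) = 0"
proof -
  define p where "p = qdot m (mat_app n a w) (mat_app n a x)"
  define b where "b = sqnorm m (mat_app n a w) * (sqnorm n x * (norm p)\<^sup>2)"
  \<comment> \<open>For the chosen \<open>c\<close>, \<open>max\<close> compares two polynomials in
    \<open>t\<close>: the constant terms cancel, and the nonnegative quadratic term on the left is
    dropped.\<close>
  have ineq: "2 * (norm p)\<^sup>2 * t \<le> b * t\<^sup>2" for t :: real
  proof -
    let ?c = "qcnj p * of_real t"
    let ?y = "\<lambda>i. w i + x i * ?c"
    have "qdot n w (\<lambda>i. x i * ?c) = 0" by (simp only: qdot_linear assms mult_zero_left)
    then have y: "sqnorm n ?y = 1 + sqnorm n x * ((norm p)\<^sup>2 * t\<^sup>2)"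
      by (simp only: sqnorm_add assms sqnorm_scale) (simp add: norm_mult power_mult_distrib)
    have Ay: "sqnorm m (mat_app n a ?y) = sqnorm m (mat_app n a w) + 2 * ((norm p)\<^sup>2 * t) +
        sqnorm m (mat_app n a x) * ((norm p)\<^sup>2 * t\<^sup>2)"
    proof -
      have "p * ?c = of_real ((norm p)\<^sup>2 * t)"
        by (simp add: qcnj_mult_self flip: mult.assoc)
      then show ?thesis
        unfolding mat_app_linear sqnorm_add qdot_linear sqnorm_scale p_def[symmetric]
        by (simp add: norm_mult power_mult_distrib del: of_real_mult)
    qed
    have "2 * ((norm p)\<^sup>2 * t) + sqnorm m (mat_app n a x) * ((norm p)\<^sup>2 * t\<^sup>2) \<le> b * t\<^sup>2"
      using max[of ?c] unfolding y Ay b_def by (simp add: algebra_simps)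
    moreover have "0 \<le> sqnorm m (mat_app n a x) * ((norm p)\<^sup>2 * t\<^sup>2)" by simp
    ultimately show ?thesis by linarith
  qed
  have "(norm p)\<^sup>2 \<le> 0"
  proof (cases "b = 0")
    case True
    then show ?thesis using ineq[of 1] by simp
  next
    case False
    have "b \<ge> 0" by (simp add: b_def)
    with False have "b > 0" by simp
    \<comment> \<open>The choice \<open>t = (norm p)\<^sup>2 / b\<close> makes the right side half
      of the left, which is possible only for \<open>p = 0\<close>.\<close>
    then have "2 * (norm p)\<^sup>2 * ((norm p)\<^sup>2 / b) \<le> b * ((norm p)\<^sup>2 / b)\<^sup>2"
      by (intro ineq)
    with \<open>b > 0\<close> have "2 * ((norm p)\<^sup>2)\<^sup>2 \<le> ((norm p)\<^sup>2)\<^sup>2"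
      by (simp add: power2_eq_square field_simps)
    then show ?thesis by simp
  qed
  then show ?thesis by (simp add: p_def)
qed

text \<open>Taking \<open>k\<close> as large as possible replaces the greedy recursion. The
  invariant makes the image of \<open>v i\<close> orthogonal to the image of everything orthogonal
  to \<open>v 0\<close>, ..., \<open>v i\<close>, not just to the other images; it therefore
  survives appending a vector.\<close>

lemma exists_singular_vectors:
  "\<exists>k v. orthonormal n k v \<and> (\<forall>i<k. sqnorm m (mat_app n a (v i)) \<noteq> 0) \<and>
     (\<forall>i<k. \<forall>x. (\<forall>l\<le>i. qdot n (v l) x = 0) \<longrightarrow> qdot m (mat_app n a (v i)) (mat_app n a x) = 0) \<and>
     (\<forall>x. (\<forall>i<k. qdot n (v i) x = 0) \<longrightarrow> (\<forall>i<m. mat_app n a x i = 0))"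
proof -
  define Q where "Q k v \<longleftrightarrow> orthonormal n k v \<and> (\<forall>i<k. sqnorm m (mat_app n a (v i)) \<noteq> 0) \<and>
     (\<forall>i<k. \<forall>x. (\<forall>l\<le>i. qdot n (v l) x = 0) \<longrightarrow> qdot m (mat_app n a (v i)) (mat_app n a x) = 0)"
    for k v
  have "\<exists>v. Q 0 v" by (simp add: Q_def orthonormal_def)
  moreover have bound: "\<forall>k. (\<exists>v. Q k v) \<longrightarrow> k \<le> n"
    using orthonormal_le_dim by (auto simp: Q_def)
  ultimately obtain k v where Q: "Q k v" and maxk: "\<And>v'. \<not> Q (Suc k) v'"
    using GreatestI_ex_nat[of "\<lambda>k. \<exists>v. Q k v" n] Greatest_le_nat[of "\<lambda>k. \<exists>v. Q k v" _ n]
    by (metis not_less_eq_eq order_refl)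
  have "mat_app n a x i = 0" if x: "\<forall>i<k. qdot n (v i) x = 0" and i: "i < m" for x i
  proof (rule ccontr)
    assume nz: "mat_app n a x i \<noteq> 0"
    have "\<exists>j<n. x j \<noteq> 0"
    proof (rule ccontr)
      assume "\<not> (\<exists>j<n. x j \<noteq> 0)"
      then have "mat_app n a x i = 0" by (simp add: mat_app_def)
      with nz show False ..
    qed
    from Q have orth: "orthonormal n k v" by (simp add: Q_def)
    obtain c :: real where "orthonormal n (Suc k) (v(k := \<lambda>i. x i * of_real c))"
      using orthonormal_snoc_normalize[OF orth] x \<open>\<exists>j<n. x j \<noteq> 0\<close> by blast
    then have "k < n" using orthonormal_le_dim by force
    then obtain w where w: "sqnorm n w = 1" "\<forall>i<k. qdot n (v i) w = 0"
      "\<And>x. \<forall>i<k. qdot n (v i) x = 0 \<Longrightarrow>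
        sqnorm m (mat_app n a x) \<le> sqnorm m (mat_app n a w) * sqnorm n x"
      using exists_maximal_direction[OF orth, of m a] by blast
    have "sqnorm m (mat_app n a x) \<noteq> 0" using nz i by (auto simp: sqnorm_eq_0_iff)
    then have "0 < sqnorm m (mat_app n a x)" by (simp add: less_le)
    \<comment> \<open>The maximum at \<open>w\<close> dominates the nonzero image of
      \<open>x\<close>.\<close>
    with w(3)[OF x] have "sqnorm m (mat_app n a w) \<noteq> 0" by auto
    moreover have "qdot m (mat_app n a w) (mat_app n a y) = 0"
      if y: "\<forall>l<k. qdot n (v l) y = 0" "qdot n w y = 0" for y
    proof (rule maximal_direction_orthogonal[OF w(1) y(2)])
      fix c
      show "sqnorm m (mat_app n a (\<lambda>i. w i + y i * c)) \<le>
          sqnorm m (mat_app n a w) * sqnorm n (\<lambda>i. w i + y i * c)"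
        using w(2) y(1) by (intro w(3)) (simp add: qdot_linear)
    qed
    ultimately have "Q (Suc k) (v(k := w))"
      using Q orthonormal_snoc[OF orth _ w(1)] w(2)
      by (auto simp: Q_def less_Suc_eq le_less)
    with maxk show False by blast
  qed
  with Q show ?thesis unfolding Q_def by blast
qed

text \<open>With \<open>d k\<close> the length of the image of \<open>v k\<close> and
  \<open>u k\<close> that image normalized, the formula is the completeness relation of
  \<open>v\<close> inserted to the right of \<open>a\<close>. The terms from \<open>p\<close> on
  vanish, since those \<open>v k\<close> are orthogonal to all singular vectors.\<close>

lemma svd_functions:
  "\<exists>p u v d. p \<le> m \<and> p \<le> n \<and> orthonormal m m u \<and> orthonormal n n v \<and> (\<forall>k<p. 0 < (d k :: real)) \<and>
     (\<forall>i<m. \<forall>j<n. a i j = (\<Sum>k<p. u k i * of_real (d k) * qcnj (v k j)))"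
proof -
  obtain p v0 where v0: "orthonormal n p v0" "\<forall>i<p. sqnorm m (mat_app n a (v0 i)) \<noteq> 0"
     "\<forall>i<p. \<forall>x. (\<forall>l\<le>i. qdot n (v0 l) x = 0) \<longrightarrow> qdot m (mat_app n a (v0 i)) (mat_app n a x) = 0"
     "\<forall>x. (\<forall>i<p. qdot n (v0 i) x = 0) \<longrightarrow> (\<forall>i<m. mat_app n a x i = 0)"
    using exists_singular_vectors[of n m a] by blast
  obtain v where v: "orthonormal n n v" "\<forall>i<p. v i = v0 i"
    using orthonormal_extend[OF v0(1)] by blast
  have "p \<le> n" using orthonormal_le_dim[OF v0(1)] .
  define d where "d k = sqrt (sqnorm m (mat_app n a (v k)))" for k
  have dpos: "0 < d k" if "k < p" for k
    using v0(2) v(2) that by (simp add: d_def less_le)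
  define u0 where "u0 k i = mat_app n a (v k) i * of_real (1 / d k)" for k i
  \<comment> \<open>The singular vectors give orthogonality to later images only; conjugate symmetry
    supplies the other order.\<close>
  have lt: "qdot m (u0 i) (u0 j) = 0" if "i < j" "j < p" for i j
  proof -
    have "qdot n (v0 l) (v0 j) = 0" if "l \<le> i" for l
      using orthonormal_qdot[OF v0(1), of l j] that \<open>i < j\<close> \<open>j < p\<close> by simp
    then have "qdot m (mat_app n a (v0 i)) (mat_app n a (v0 j)) = 0"
      using v0(3) that by simp
    then have "qdot m (mat_app n a (v i)) (u0 j) = 0"
      using v(2) that unfolding u0_def[abs_def] qdot_linear by simp
    then have "qdot m (u0 j) (mat_app n a (v i)) = 0" by (simp add: qdot_eq_0_commute)
    then have "qdot m (u0 j) (u0 i) = 0"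
      unfolding u0_def[of i, abs_def] qdot_linear by simp
    then show ?thesis by (simp add: qdot_eq_0_commute)
  qed
  have self: "qdot m (u0 i) (u0 i) = 1" if "i < p" for i
    using sqnorm_normalize[of m "mat_app n a (v i)"] v0(2) v(2) that
    unfolding qdot_self u0_def[abs_def] d_def by simp
  have "orthonormal m p u0"
    unfolding orthonormal_def
    by (metis lt self linorder_neqE_nat qdot_eq_0_commute)
  then obtain u where u: "orthonormal m m u" "\<forall>i<p. u i = u0 i" and "p \<le> m"
    using orthonormal_extend orthonormal_le_dim by blast
  have "a i j = (\<Sum>k<p. u k i * of_real (d k) * qcnj (v k j))" if "i < m" "j < n" for i j
  proof -
    have "a i j = (\<Sum>l<n. a i l * (\<Sum>k<n. v k l * qcnj (v k j)))"
      using that by (simp add: orthonormal_basis_completeness[OF v(1)] if_distrib cong: if_cong)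
    also have "\<dots> = (\<Sum>k<n. mat_app n a (v k) i * qcnj (v k j))"
      unfolding mat_app_def sum_distrib_left sum_distrib_right mult.assoc[symmetric]
      by (rule sum.swap)
    also have "\<dots> = (\<Sum>k<p. mat_app n a (v k) i * qcnj (v k j))"
    proof (rule sum.mono_neutral_right)
      show "\<forall>k\<in>{..<n} - {..<p}. mat_app n a (v k) i * qcnj (v k j) = 0"
      proof
        fix k assume k: "k \<in> {..<n} - {..<p}"
        then have "\<forall>l<p. qdot n (v0 l) (v k) = 0"
          using v orthonormal_qdot[OF v(1), of _ k] \<open>p \<le> n\<close> by (metis DiffD1 DiffD2 lessThan_iff order_less_le_trans)
        with v0(4) \<open>i < m\<close> show "mat_app n a (v k) i * qcnj (v k j) = 0" by simp
      qed
    qed (use \<open>p \<le> n\<close> in auto)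
    also have "\<dots> = (\<Sum>k<p. u k i * of_real (d k) * qcnj (v k j))"
    proof (intro sum.cong refl arg_cong2[where f = "(*)"])
      fix k assume "k \<in> {..<p}"
      then show "mat_app n a (v k) i = u k i * of_real (d k)"
        using u(2) dpos[of k] by (simp add: u0_def mult.assoc del: of_real_divide flip: of_real_mult)
    qed
    finally show ?thesis .
  qed
  with dpos u v \<open>p \<le> m\<close> \<open>p \<le> n\<close> show ?thesis by blast
qed

section \<open>Rank and matrix form of the decomposition\<close>

text \<open>Adding a new \<open>j\<close> to an independent set of maximal size breaks independence.
  In the resulting relation the coefficient at \<open>j\<close> is nonzero, by independence of
  \<open>S\<close>, and is divided out on the right.\<close>

lemma right_indep_cols_spanning:
  assumes "S \<subseteq> {..<dim_col A}" "right_indep_cols A S" "j < dim_col A"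
    and max: "\<And>T. T \<subseteq> {..<dim_col A} \<Longrightarrow> right_indep_cols A T \<Longrightarrow> card T \<le> card S"
  shows "\<exists>c. \<forall>i<dim_row A. A $$ (i, j) = (\<Sum>s\<in>S. A $$ (i, s) * c s)"
proof (cases "j \<in> S")
  case True
  with assms(1) show ?thesis
    by (intro exI[of _ "\<lambda>s. if s = j then 1 else 0"])
      (simp add: finite_subset if_distrib cong: if_cong)
next
  case False
  have fin: "finite S" using assms(1) finite_subset by blast
  with False have "\<not> card (insert j S) \<le> card S" by simp
  then have "\<not> right_indep_cols A (insert j S)" using max[of "insert j S"] assms(1,3) by auto
  then obtain c where c: "\<forall>i<dim_row A. (\<Sum>s\<in>insert j S. A $$ (i, s) * c s) = 0"
    "\<exists>s\<in>insert j S. c s \<noteq> 0"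
    unfolding right_indep_cols_def by blast
  from c(1) have c1: "A $$ (i, j) * c j + (\<Sum>s\<in>S. A $$ (i, s) * c s) = 0" if "i < dim_row A" for i
    using that False fin by simp
  have cj: "c j \<noteq> 0"
  proof
    assume "c j = 0"
    with c1 have "\<forall>s\<in>S. c s = 0" using assms(2) unfolding right_indep_cols_def by simp
    with \<open>c j = 0\<close> c(2) show False by blast
  qed
  have "A $$ (i, j) = (\<Sum>s\<in>S. A $$ (i, s) * (- c s * inverse (c j)))" if "i < dim_row A" for i
  proof -
    have "(\<Sum>s\<in>S. A $$ (i, s) * (- c s * inverse (c j))) =
        - (\<Sum>s\<in>S. A $$ (i, s) * c s) * inverse (c j)"
      by (simp add: sum_distrib_right sum_negf mult.assoc)
    also have "- (\<Sum>s\<in>S. A $$ (i, s) * c s) = A $$ (i, j) * c j"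
      using c1[OF that] by (metis add.commute minus_unique)
    finally show ?thesis using cj by (simp add: mult.assoc)
  qed
  then show ?thesis by (intro exI[of _ "\<lambda>s. - c s * inverse (c j)"] allI impI)
qed

text \<open>More than \<open>p\<close> columns are dependent: \<open>p\<close> homogeneous equations
  yield a nonzero combination annihilated by every conjugated \<open>v k\<close> with
  \<open>k < p\<close>, hence by \<open>A\<close>. The lower bound is a dimension count on a maximal
  independent set of columns.\<close>

lemma quat_rank_diagonal_form:
  assumes u: "orthonormal (dim_row A) (dim_row A) u" and v: "orthonormal (dim_col A) (dim_col A) v"
    and p: "p \<le> dim_row A" "p \<le> dim_col A" and d: "\<And>k. k < p \<Longrightarrow> d k \<noteq> 0"
    and A: "\<And>i j. i < dim_row A \<Longrightarrow> j < dim_col A \<Longrightarrow>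
      A $$ (i, j) = (\<Sum>k<p. u k i * of_real (d k) * qcnj (v k j))"
  shows "quat_rank A = p"
proof -
  let ?m = "dim_row A" and ?n = "dim_col A"
  let ?F = "{S. S \<subseteq> {..<?n} \<and> right_indep_cols A S}"
  have "finite ?F" by (rule finite_subset[of _ "Pow {..<?n}"]) auto
  moreover have "{} \<in> ?F" by (simp add: right_indep_cols_def)
  ultimately have "quat_rank A \<in> card ` ?F" and ge: "\<And>T. T \<in> ?F \<Longrightarrow> card T \<le> quat_rank A"
    unfolding quat_rank_def by (auto intro!: Max_in Max_ge)
  then obtain S where S: "S \<subseteq> {..<?n}" "right_indep_cols A S" "card S = quat_rank A" by auto
  have fin: "finite S" using S(1) finite_subset by blast
  have "card S \<le> p"
  proof (rule ccontr)
    assume "\<not> card S \<le> p"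
    then obtain x where x: "\<exists>j\<in>S. x j \<noteq> 0" "\<forall>k\<in>{..<p}. (\<Sum>j\<in>S. qcnj (v k j) * x j) = 0"
      using homogeneous_system_nontrivial[of "{..<p}" S "\<lambda>k j. qcnj (v k j)"] fin by auto
    have "(\<Sum>j\<in>S. A $$ (i, j) * x j) = 0" if "i < ?m" for i
    proof -
      have "(\<Sum>j\<in>S. A $$ (i, j) * x j) =
          (\<Sum>j\<in>S. \<Sum>k<p. u k i * of_real (d k) * (qcnj (v k j) * x j))"
        using S(1) that by (intro sum.cong refl) (auto simp: A sum_distrib_right mult.assoc)
      also have "\<dots> = (\<Sum>k<p. u k i * of_real (d k) * (\<Sum>j\<in>S. qcnj (v k j) * x j))"
        unfolding sum_distrib_left by (rule sum.swap)
      finally show ?thesis using x(2) by simp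
    qed
    with S(2) x(1) show False unfolding right_indep_cols_def by blast
  qed
  \<comment> \<open>If all columns depend on those in \<open>S\<close>, then \<open>A\<close> factors through a space of dimension \<open>card S\<close>,
    which cannot carry the invertible \<open>p\<close> by \<open>p\<close> diagonal block.\<close>
  moreover have "p \<le> card S"
  proof (rule ccontr)
    assume less: "\<not> p \<le> card S"
    have "\<forall>j\<in>{..<?n}. \<exists>c. \<forall>i<?m. A $$ (i, j) = (\<Sum>s\<in>S. A $$ (i, s) * c s)"
      using right_indep_cols_spanning[OF S(1,2)] ge S(3) by simp
    then obtain c where c: "\<forall>j\<in>{..<?n}. \<forall>i<?m. A $$ (i, j) = (\<Sum>s\<in>S. A $$ (i, s) * c j s)"
      by metis
    obtain x where x: "\<exists>k\<in>{..<p}. x k \<noteq> 0"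
      "\<forall>s\<in>S. (\<Sum>k<p. (\<Sum>j<?n. c j s * v k j) * x k) = 0"
      using homogeneous_system_nontrivial[of S "{..<p}" "\<lambda>s k. \<Sum>j<?n. c j s * v k j"] fin less
      by auto
    \<comment> \<open>By the choice of \<open>x\<close>, \<open>A\<close> annihilates this
      combination of \<open>v 0\<close>, ..., \<open>v (p - 1)\<close>; yet its coefficients
      \<open>x k\<close> can be read off from its image, as every \<open>d k\<close> is
      nonzero.\<close>
    define y where "y j = (\<Sum>k<p. v k j * x k)" for j
    have Ay: "(\<Sum>j<?n. A $$ (i, j) * y j) = 0" if "i < ?m" for i
    proof -
      have "(\<Sum>j<?n. c j s * y j) = (\<Sum>k<p. (\<Sum>j<?n. c j s * v k j) * x k)" for s
        unfolding y_def sum_distrib_left sum_distrib_right mult.assoc[symmetric] by (rule sum.swap)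
      then have cy: "\<forall>s\<in>S. (\<Sum>j<?n. c j s * y j) = 0" using x(2) by simp
      have "(\<Sum>j<?n. A $$ (i, j) * y j) = (\<Sum>j<?n. (\<Sum>s\<in>S. A $$ (i, s) * c j s) * y j)"
        using c that by (intro sum.cong refl) (metis lessThan_iff)
      also have "\<dots> = (\<Sum>s\<in>S. A $$ (i, s) * (\<Sum>j<?n. c j s * y j))"
        unfolding sum_distrib_left sum_distrib_right mult.assoc[symmetric] by (rule sum.swap)
      finally show ?thesis using cy by simp
    qed
    have vy: "(\<Sum>j<?n. qcnj (v k j) * y j) = x k" if "k < p" for k
    proof -
      have "orthonormal ?n p v" using v p(2) by (simp add: orthonormal_def)
      from orthonormal_qdot_combination[OF this that, of x] show ?thesis
        by (simp add: qdot_def y_def)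
    qed
    have "(\<Sum>k<p. u k i * (of_real (d k) * x k)) = 0" if "i < ?m" for i
    proof -
      have "0 = (\<Sum>j<?n. A $$ (i, j) * y j)" using Ay that by simp
      also have "\<dots> = (\<Sum>j<?n. \<Sum>k<p. u k i * of_real (d k) * (qcnj (v k j) * y j))"
        using that by (intro sum.cong refl) (auto simp: A sum_distrib_right mult.assoc)
      also have "\<dots> = (\<Sum>k<p. u k i * of_real (d k) * (\<Sum>j<?n. qcnj (v k j) * y j))"
        unfolding sum_distrib_left by (rule sum.swap)
      finally show ?thesis by (simp add: vy mult.assoc)
    qed
    moreover have "orthonormal ?m p u" using u p(1) by (simp add: orthonormal_def)
    ultimately have "of_real (d l) * x l = 0" if "l < p" for l
      using orthonormal_qdot_combination[of ?m p u l "\<lambda>k. of_real (d k) * x k"] that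
      by (simp add: qdot_def)
    then have "x l = 0" if "l < p" for l using d that by simp
    with x(1) show False by auto
  qed
  ultimately show ?thesis using S(3) by simp
qed

section \<open>Unitary matrices and the matrix form of the decomposition\<close>

definition cols_mat :: "nat \<Rightarrow> (nat \<Rightarrow> nat \<Rightarrow> quat) \<Rightarrow> quat mat" where
  "cols_mat n v = Matrix.mat n n (\<lambda>(i, k). v k i)"

lemma cols_mat_carrier: "cols_mat n v \<in> carrier_mat n n"
  by (simp add: cols_mat_def)

lemma cols_mat_entry: "i < n \<Longrightarrow> k < n \<Longrightarrow> cols_mat n v $$ (i, k) = v k i"
  by (simp add: cols_mat_def)

lemma mat_times_entry:
  assumes "A \<in> carrier_mat l m" "B \<in> carrier_mat m n" "i < l" "j < n"
  shows "(A * B) $$ (i, j) = (\<Sum>k<m. A $$ (i, k) * B $$ (k, j))"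
  using assms
  by (simp add: scalar_prod_def atLeast0LessThan)

lemma dim_mat_ctranspose [simp]:
  "dim_row (mat_ctranspose A) = dim_col A" "dim_col (mat_ctranspose A) = dim_row A"
  by (simp_all add: mat_ctranspose_def)

lemma mat_ctranspose_carrier:
  "A \<in> carrier_mat m n \<Longrightarrow> mat_ctranspose A \<in> carrier_mat n m"
  by (simp add: mat_ctranspose_def)

lemma mat_ctranspose_entry:
  "A \<in> carrier_mat m n \<Longrightarrow> i < n \<Longrightarrow> j < m \<Longrightarrow> mat_ctranspose A $$ (i, j) = qcnj (A $$ (j, i))"
  by (simp add: mat_ctranspose_def)

text \<open>One product is the completeness relation of the system, the other its
  orthonormality.\<close>

lemma unitary_cols_mat:
  assumes "orthonormal n n v"
  shows "unitary_quat_mat n (cols_mat n v)"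
proof -
  note c = cols_mat_carrier[of n v]
  note ct = mat_ctranspose_carrier[OF c]
  note entries = mat_times_entry[OF c ct] mat_times_entry[OF ct c] mat_ctranspose_entry[OF c]
    cols_mat_entry
  have "cols_mat n v * mat_ctranspose (cols_mat n v) = 1\<^sub>m n"
    by (rule eq_matI) (use c ct orthonormal_basis_completeness[OF assms] in
      \<open>simp_all add: entries del: index_mult_mat(1)\<close>)
  moreover have "mat_ctranspose (cols_mat n v) * cols_mat n v = 1\<^sub>m n"
    by (rule eq_matI) (use c ct orthonormal_qdot[OF assms] in
      \<open>simp_all add: entries qdot_def del: index_mult_mat(1)\<close>)
  ultimately show ?thesis using c by (simp add: unitary_quat_mat_def)
qed

text \<open>The sum of \<open>p\<close> terms becomes a matrix product with a rectangular diagonal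
  factor; that \<open>p\<close> is the rank, as \<open>positive_singular_values\<close> demands,
  comes from \<open>quat_rank_diagonal_form\<close>.\<close>

theorem quat_svd_exists: "\<exists>ds. positive_singular_values A ds"
proof -
  let ?m = "dim_row A" and ?n = "dim_col A"
  obtain p u v d where p: "p \<le> ?m" "p \<le> ?n" and u: "orthonormal ?m ?m u"
    and v: "orthonormal ?n ?n v" and d: "\<forall>k<p. 0 < (d k :: real)"
    and A: "\<And>i j. i < ?m \<Longrightarrow> j < ?n \<Longrightarrow>
      A $$ (i, j) = (\<Sum>k<p. u k i * of_real (d k) * qcnj (v k j))"
    using svd_functions[of ?m ?n "\<lambda>i j. A $$ (i, j)"] by blast
  define ds where "ds = map d [0..<p]"
  let ?U = "cols_mat ?m u" and ?V = "cols_mat ?n v"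
  let ?D = "Matrix.mat ?m ?n (\<lambda>(i, j). if i = j \<and> i < length ds then of_real (ds ! i) else 0) :: quat mat"
  have c: "?U \<in> carrier_mat ?m ?m" "?V \<in> carrier_mat ?n ?n" "?D \<in> carrier_mat ?m ?n"
    by (simp_all add: cols_mat_carrier)
  have UD: "(?U * ?D) $$ (i, k) = (if k < p then u k i * of_real (d k) else 0)"
    if "i < ?m" "k < ?n" for i k
  proof -
    have "(?U * ?D) $$ (i, k) = (\<Sum>l<?m. if l = k then (if k < p then u k i * of_real (d k) else 0) else 0)"
      unfolding mat_times_entry[OF c(1,3) that]
      using that by (intro sum.cong refl) (auto simp: cols_mat_entry ds_def)
    then show ?thesis using p by simp
  qed
  have "A = ?U * ?D * mat_ctranspose ?V"
  proof (rule eq_matI)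
    fix i j assume "i < dim_row (?U * ?D * mat_ctranspose ?V)" "j < dim_col (?U * ?D * mat_ctranspose ?V)"
    then have ij: "i < ?m" "j < ?n" using c mat_ctranspose_carrier[OF c(2)] by auto
    have "(?U * ?D * mat_ctranspose ?V) $$ (i, j) =
        (\<Sum>k<?n. (if k < p then u k i * of_real (d k) * qcnj (v k j) else 0))"
      unfolding mat_times_entry[OF mult_carrier_mat[OF c(1,3)] mat_ctranspose_carrier[OF c(2)] ij]
      using ij by (intro sum.cong refl) (auto simp: UD mat_ctranspose_entry[OF c(2)] cols_mat_entry)
    also have "\<dots> = (\<Sum>k<p. u k i * of_real (d k) * qcnj (v k j))"
      using p(2) by (intro sum.mono_neutral_cong_right) auto
    finally show "A $$ (i, j) = (?U * ?D * mat_ctranspose ?V) $$ (i, j)"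
      using A ij by simp
  qed (use c mat_ctranspose_carrier[OF c(2)] in auto)
  moreover have "quat_rank A = p"
    using quat_rank_diagonal_form[OF u v p _ A] d by fastforce
  moreover have "length ds = p" "\<forall>x\<in>set ds. 0 < x" using d by (auto simp: ds_def)
  ultimately have "positive_singular_values A ds"
    unfolding positive_singular_values_def
    using unitary_cols_mat[OF u] unitary_cols_mat[OF v] by blast
  then show ?thesis ..
qed

section \<open>Tensors and their matrices\<close>

definition delin :: "nat list \<Rightarrow> nat \<Rightarrow> nat list" where
  "delin ds a = inv_into (indices ds) (linear_index ds) (Suc a)"

lemma length_indices: "ix \<in> indices ds \<Longrightarrow> length ix = length ds"
  by (simp add: indices_def)

lemma delin_bij:
  assumes "ds \<noteq> []"
  shows "bij_betw (delin ds) {..<prod_list ds} (indices ds)"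
proof -
  have "bij_betw Suc {..<prod_list ds} {1..prod_list ds}"
    by (rule bij_betw_byWitness[where f' = "\<lambda>a. a - 1"]) auto
  then have "bij_betw (inv_into (indices ds) (linear_index ds) \<circ> Suc) {..<prod_list ds} (indices ds)"
    by (rule bij_betw_trans) (rule bij_betw_inv_into[OF linear_index_bij[OF assms]])
  also have "inv_into (indices ds) (linear_index ds) \<circ> Suc = delin ds"
    by (simp add: fun_eq_iff delin_def)
  finally show ?thesis .
qed

lemma delin_in_indices: "ds \<noteq> [] \<Longrightarrow> a < prod_list ds \<Longrightarrow> delin ds a \<in> indices ds"
  using bij_betwE[OF delin_bij] by blast

lemma linear_index_delin:
  assumes "ds \<noteq> []" "a < prod_list ds"
  shows "linear_index ds (delin ds a) = Suc a"
  using linear_index_bij[OF assms(1)] assms(2)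
  by (auto simp: delin_def bij_betw_def intro!: f_inv_into_f)

lemma linear_index_range:
  assumes "ds \<noteq> []" "ix \<in> indices ds"
  shows "1 \<le> linear_index ds ix" "linear_index ds ix \<le> prod_list ds"
  using bij_betwE[OF linear_index_bij[OF assms(1)]] assms(2) by fastforce+

lemma unfold_matrix_nth:
  assumes "dims A = Is @ Js" "length Is = N" "a < prod_list Is" "b < prod_list Js"
  shows "unfold_matrix N A $$ (a, b) = A $\<^sub>t (delin Is a @ delin Js b)"
  using assms by (simp add: unfold_matrix_def delin_def)

lemma unfold_matrix_carrier:
  assumes "dims A = Is @ Js" "length Is = N"
  shows "unfold_matrix N A \<in> carrier_mat (prod_list Is) (prod_list Js)"
  using assms by (simp add: unfold_matrix_def)

text \<open>Every multi-index splits at \<open>N\<close> into a row part and a column part, so each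
  tensor entry occurs in the matrix. Tensor identities can thus be checked on matrices.\<close>

lemma unfold_matrix_inject:
  assumes "dims A = Is @ Js" "dims B = Is @ Js" "length Is = N" "Is \<noteq> []" "Js \<noteq> []"
    and "unfold_matrix N A = unfold_matrix N B"
  shows "A = B"
proof (rule tensor_eqI)
  fix ix assume "ix \<in> indices (dims B)"
  then have ix: "ix \<in> indices (Is @ Js)" using assms by simp
  then have "length (take N ix) = length Is"
    using assms(3) by (simp add: length_indices)
  then have "take N ix \<in> indices Is" "drop N ix \<in> indices Js"
    using indices_append_iff[of "take N ix" Is "drop N ix" Js] ix by simp_all
  then have "A $\<^sub>t (take N ix @ drop N ix) = B $\<^sub>t (take N ix @ drop N ix)"
    using unfold_matrix_entry assms by metis
  then show "A $\<^sub>t ix = B $\<^sub>t ix" by simp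
qed (use assms in simp)

section \<open>Compatibility of unfolding with product, conjugate transpose and unit\<close>

definition fold_tensor :: "nat list \<Rightarrow> nat list \<Rightarrow> 'a mat \<Rightarrow> 'a tensor" where
  "fold_tensor Is Js M = tensor (Is @ Js)
     (\<lambda>ix. M $$ (linear_index Is (take (length Is) ix) - 1, linear_index Js (drop (length Is) ix) - 1))"

lemma dims_fold_tensor [simp]: "dims (fold_tensor Is Js M) = Is @ Js"
  by (simp add: fold_tensor_def)

lemma fold_tensor_entry:
  assumes "is \<in> indices Is" "js \<in> indices Js"
  shows "fold_tensor Is Js M $\<^sub>t (is @ js) = M $$ (linear_index Is is - 1, linear_index Js js - 1)"
  using assms by (simp add: fold_tensor_def indices_append_iff length_indices)

lemma unfold_fold_tensor:
  assumes "M \<in> carrier_mat (prod_list Is) (prod_list Js)" "length Is = N" "Is \<noteq> []" "Js \<noteq> []"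
  shows "unfold_matrix N (fold_tensor Is Js M) = M"
  using assms unfold_matrix_carrier[of "fold_tensor Is Js M" Is Js N]
  by (intro eq_matI)
    (simp_all add: unfold_matrix_nth[of _ Is Js] fold_tensor_entry delin_in_indices linear_index_delin)

lemma dims_einstein_prod:
  assumes "dims A = Is @ Js" "dims B = Js @ Ks" "length Is = N" "length Js = N"
  shows "dims (A *\<^bsub>N\<^esub> B) = Is @ Ks"
  using assms by (simp add: einstein_prod_def)

lemma dims_ctranspose: "dims A = Is @ Js \<Longrightarrow> length Is = N \<Longrightarrow> dims (ctranspose N A) = Js @ Is"
  by (simp add: ctranspose_def)

lemma unfold_einstein_prod:
  assumes "dims A = Is @ Js" "dims B = Js @ Ks" "length Is = N" "length Js = N"
    and "Is \<noteq> []" "Js \<noteq> []" "Ks \<noteq> []"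
  shows "unfold_matrix N (A *\<^bsub>N\<^esub> B) = unfold_matrix N A * unfold_matrix N B"
proof (rule eq_matI)
  note cA = unfold_matrix_carrier[OF assms(1,3)] and cB = unfold_matrix_carrier[OF assms(2,4)]
  note cAB = unfold_matrix_carrier[OF dims_einstein_prod[OF assms(1-4)] assms(3)]
  fix i k assume "i < dim_row (unfold_matrix N A * unfold_matrix N B)"
    "k < dim_col (unfold_matrix N A * unfold_matrix N B)"
  then have ik: "i < prod_list Is" "k < prod_list Ks" using cA cB by auto
  have d: "delin Is i \<in> indices Is" "delin Ks k \<in> indices Ks"
    using assms ik by (simp_all add: delin_in_indices)
  have "unfold_matrix N (A *\<^bsub>N\<^esub> B) $$ (i, k) =
      (\<Sum>js\<in>indices Js. A $\<^sub>t (delin Is i @ js) * B $\<^sub>t (js @ delin Ks k))"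
    using assms d ik
    by (simp add: unfold_matrix_nth[OF dims_einstein_prod[OF assms(1-4)] assms(3)])
      (simp add: einstein_prod_def indices_append_iff length_indices)
  \<comment> \<open>\<open>delin Js\<close> enumerates the contracted multi-indices, turning the
    multiple sum into one over the inner matrix index.\<close>
  also have "\<dots> = (\<Sum>j<prod_list Js. A $\<^sub>t (delin Is i @ delin Js j) * B $\<^sub>t (delin Js j @ delin Ks k))"
    by (rule sum.reindex_bij_betw[OF delin_bij[OF assms(6)], symmetric])
  also have "\<dots> = (unfold_matrix N A * unfold_matrix N B) $$ (i, k)"
    using ik unfold_matrix_nth[OF assms(1,3)] unfold_matrix_nth[OF assms(2,4)]
    by (simp add: mat_times_entry[OF cA cB] del: index_mult_mat(1))
  finally show "unfold_matrix N (A *\<^bsub>N\<^esub> B) $$ (i, k) = (unfold_matrix N A * unfold_matrix N B) $$ (i, k)" .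
qed (use unfold_matrix_carrier[OF assms(1,3)] unfold_matrix_carrier[OF assms(2,4)]
    unfold_matrix_carrier[OF dims_einstein_prod[OF assms(1-4)] assms(3)] in auto)

lemma ctranspose_entry:
  assumes "dims A = Is @ Js" "length Is = N" "length Js = N"
    and "is \<in> indices Is" "js \<in> indices Js"
  shows "ctranspose N A $\<^sub>t (js @ is) = qcnj (A $\<^sub>t (is @ js))"
  using assms by (simp add: ctranspose_def indices_append_iff length_indices)

lemma unfold_ctranspose:
  assumes "dims A = Is @ Js" "length Is = N" "length Js = N" "Is \<noteq> []" "Js \<noteq> []"
  shows "unfold_matrix N (ctranspose N A) = mat_ctranspose (unfold_matrix N A)"
proof (rule eq_matI)
  note cA = unfold_matrix_carrier[OF assms(1,2)]
  fix i j assume "i < dim_row (mat_ctranspose (unfold_matrix N A))"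
    "j < dim_col (mat_ctranspose (unfold_matrix N A))"
  then have ij: "i < prod_list Js" "j < prod_list Is" using cA by auto
  then have "delin Js i \<in> indices Js" "delin Is j \<in> indices Is"
    using assms by (simp_all add: delin_in_indices)
  then show "unfold_matrix N (ctranspose N A) $$ (i, j) = mat_ctranspose (unfold_matrix N A) $$ (i, j)"
    using ij unfold_matrix_nth[OF dims_ctranspose[OF assms(1,2)] assms(3) ij]
      unfold_matrix_nth[OF assms(1,2) ij(2,1)] ctranspose_entry[OF assms(1-3)]
    by (simp add: mat_ctranspose_entry[OF cA])
qed (use unfold_matrix_carrier[OF assms(1,2)]
    unfold_matrix_carrier[OF dims_ctranspose[OF assms(1,2)] assms(3)] in auto)

lemma unfold_unit_tensor:
  assumes "length Is = N" "Is \<noteq> []"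
  shows "unfold_matrix N (unit_tensor Is) = 1\<^sub>m (prod_list Is)"
proof -
  have dims: "dims (unit_tensor Is) = Is @ Is" by (simp add: unit_tensor_def)
  have inj: "delin Is i = delin Is j \<longleftrightarrow> i = j" if "i < prod_list Is" "j < prod_list Is" for i j
    using delin_bij[OF assms(2)] that by (auto simp: bij_betw_def inj_on_def)
  have entry: "unit_tensor Is $\<^sub>t (is @ js) = (if is = js then 1 else 0)"
    if "is \<in> indices Is" "js \<in> indices Is" for "is" js
    using that by (simp add: unit_tensor_def indices_append_iff length_indices)
  show ?thesis
    using unfold_matrix_carrier[OF dims assms(1)] assms
    by (intro eq_matI) (auto simp: unfold_matrix_nth[OF dims assms(1)] inj entry delin_in_indices)
qed

lemma unitary_fold_tensor:
  assumes "unitary_quat_mat (prod_list Is) M" "Is \<noteq> []"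
  shows "unitary_tensor Is (fold_tensor Is Is M)"
proof -
  let ?U = "fold_tensor Is Is M" and ?N = "length Is"
  have M: "M \<in> carrier_mat (prod_list Is) (prod_list Is)"
    using assms(1) by (simp add: unitary_quat_mat_def)
  have U: "dims ?U = Is @ Is" and Ut: "dims (ctranspose ?N ?U) = Is @ Is"
    by (simp_all add: dims_ctranspose)
  have dims_unit: "dims (unit_tensor Is) = Is @ Is" by (simp add: unit_tensor_def)
  have "?U *\<^bsub>?N\<^esub> ctranspose ?N ?U = unit_tensor Is"
    using assms
    by (intro unfold_matrix_inject[OF dims_einstein_prod[OF U Ut refl refl] dims_unit refl])
      (simp_all add: unfold_einstein_prod[OF U Ut] unfold_ctranspose[OF U] unfold_fold_tensor[OF M]
        unfold_unit_tensor unitary_quat_mat_def)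
  moreover have "ctranspose ?N ?U *\<^bsub>?N\<^esub> ?U = unit_tensor Is"
    using assms
    by (intro unfold_matrix_inject[OF dims_einstein_prod[OF Ut U refl refl] dims_unit refl])
      (simp_all add: unfold_einstein_prod[OF Ut U] unfold_ctranspose[OF U] unfold_fold_tensor[OF M]
        unfold_unit_tensor unitary_quat_mat_def)
  ultimately show ?thesis by (simp add: unitary_tensor_def)
qed

section \<open>Positions of the singular values\<close>

lemma at_position_iff_nth1:
  "at_position ds i ix \<longleftrightarrow>
     length ix = length ds \<and> (\<forall>t\<in>{1..length ds}. int (ix !\<^sub>1 t) = pos_index ds i t)"
proof -
  have eq: "(\<forall>t\<in>{1..length ds}. int (ix !\<^sub>1 t) = pos_index ds i t) \<longleftrightarrow>
      (\<forall>t<length ds. int (ix ! t) = pos_index ds i (Suc t))"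
    unfolding image_Suc_lessThan[symmetric] by auto
  have "length (map (pos_index ds i) [1..<length ds + 1]) = length ds"
    by (simp del: upt_Suc)
  moreover have "map (pos_index ds i) [1..<length ds + 1] ! t = pos_index ds i (Suc t)"
    if "t < length ds" for t
    using that by (simp del: upt_Suc)
  ultimately show ?thesis
    unfolding at_position_def list_eq_iff_nth_eq eq length_map by (metis nth_map)
qed

lemma indices_nth1_le:
  assumes "ix \<in> indices ds" "t \<in> {1..length ds}"
  shows "1 \<le> ix !\<^sub>1 t" "ix !\<^sub>1 t \<le> ds !\<^sub>1 t"
  using assms by (auto simp: indices_def)

text \<open>Each digit \<open>ix !\<^sub>1 k - 1\<close> is smaller than its radix, so the low
  digits never reach the next place value. This lets the floor recover one digit at a time.\<close>

lemma mixed_radix_less: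
  assumes "ix \<in> indices ds" "t \<le> length ds"
  shows "(\<Sum>k\<in>{1..t}. (ix !\<^sub>1 k - 1) * (\<Prod>s\<in>{1..k-1}. ds !\<^sub>1 s)) < (\<Prod>s\<in>{1..t}. ds !\<^sub>1 s)"
  using assms(2)
proof (induction t)
  case 0
  then show ?case by simp
next
  case (Suc t)
  let ?P = "\<Prod>s\<in>{1..t}. ds !\<^sub>1 s"
  have "1 \<le> ix ! t" "ix ! t \<le> ds ! t"
    using indices_nth1_le[OF assms(1), of "Suc t"] Suc.prems by auto
  then have le: "(ix ! t - 1) * ?P + ?P \<le> ds ! t * ?P"
    by (metis add.commute le_add_diff_inverse mult_Suc mult_le_mono1 plus_1_eq_Suc)
  have "(\<Sum>k\<in>{1..t}. (ix !\<^sub>1 k - 1) * (\<Prod>s\<in>{1..k-1}. ds !\<^sub>1 s)) < ?P"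
    using Suc by simp
  with le show ?case by (simp add: mult.commute)
qed

text \<open>The component singled out in \<open>linear_index\<close> is the digit of place value 1,
  the empty product, raised by 1 because indices start at 1.\<close>

lemma linear_index_eq_sum:
  assumes "ix \<in> indices ds" "ds \<noteq> []"
  shows "linear_index ds ix = 1 + (\<Sum>k\<in>{1..length ds}. (ix !\<^sub>1 k - 1) * (\<Prod>s\<in>{1..k-1}. ds !\<^sub>1 s))"
proof -
  have "{1..length ds} = insert 1 {2..length ds}" using assms(2) by (cases ds) auto
  then show ?thesis
    using indices_nth1_le(1)[OF assms(1), of 1] assms(2)
    by (simp add: linear_index_def Suc_le_eq)
qed

text \<open>Induction from the highest component down. Removing the higher digits from the linear
  index minus 1 leaves digit \<open>t\<close> times its place value plus a remainder below that
  value, so the floor of the quotient is the digit.\<close>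

lemma pos_index_linear_index:
  assumes ix: "ix \<in> indices ds" and "ds \<noteq> []" and "t \<in> {1..length ds}"
  shows "pos_index ds (linear_index ds ix) t = int (ix !\<^sub>1 t)"
  using assms(3)
proof (induction "length ds - t" arbitrary: t rule: less_induct)
  case less
  let ?i = "linear_index ds ix"
  let ?P = "\<lambda>k. \<Prod>s\<in>{1..k-1}. ds !\<^sub>1 s"
  let ?w = "\<lambda>k. (ix !\<^sub>1 k - 1) * ?P k"
  have upper: "(\<Sum>k\<in>{t+1..length ds}. (pos_index ds ?i k - 1) * int (?P k)) =
      int (\<Sum>k\<in>{t+1..length ds}. ?w k)"
    unfolding of_nat_sum
  proof (rule sum.cong[OF refl])
    fix k assume k: "k \<in> {t+1..length ds}"
    then have "pos_index ds ?i k = int (ix !\<^sub>1 k)" using less by auto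
    moreover have "1 \<le> ix !\<^sub>1 k" using indices_nth1_le(1)[OF ix, of k] k by simp
    ultimately show "(pos_index ds ?i k - 1) * int (?P k) = int (?w k)"
      by (simp add: of_nat_diff)
  qed
  have eq: "{1..length ds} = {1..t-1} \<union> insert t {t+1..length ds}" using less.prems by auto
  have split: "(\<Sum>k\<in>{1..length ds}. ?w k) =
      (\<Sum>k\<in>{1..t-1}. ?w k) + ?w t + (\<Sum>k\<in>{t+1..length ds}. ?w k)"
    unfolding eq using less.prems by (subst sum.union_disjoint) auto
  have rem: "int ?i - 1 - int (\<Sum>k\<in>{t+1..length ds}. ?w k) = int (\<Sum>k\<in>{1..t-1}. ?w k) + int (?w t)"
    unfolding linear_index_eq_sum[OF ix assms(2)] split by simp
  have pos: "1 \<le> ix !\<^sub>1 t" using indices_nth1_le(1)[OF ix less.prems] .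
  show ?case
  proof (cases "t = 1")
    \<comment> \<open>With no lower digits and place value 1 there is nothing to divide; not
      subtracting 1 from \<open>?i\<close> replaces adding 1 at the end.\<close>
    case True
    with upper have "pos_index ds ?i t = int ?i - int (\<Sum>k\<in>{2..length ds}. ?w k)"
      by (subst pos_index.simps) (simp add: numeral_2_eq_2)
    with rem pos True show ?thesis by (simp add: of_nat_diff numeral_2_eq_2)
  next
    case False
    have less_P: "(\<Sum>k\<in>{1..t-1}. ?w k) < ?P t"
      by (rule mixed_radix_less[OF ix]) (use less.prems in auto)
    have "pos_index ds ?i t = \<lfloor>real_of_int (int (\<Sum>k\<in>{1..t-1}. ?w k) + int (?w t)) / real (?P t)\<rfloor> + 1"
      using False by (subst pos_index.simps) (simp only: upper rem if_False)
    also have "\<dots> = \<lfloor>real ((\<Sum>k\<in>{1..t-1}. ?w k) + ?w t) / real (?P t)\<rfloor> + 1"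
      by (simp only: of_int_of_nat_eq flip: of_nat_add)
    also have "\<dots> = int (((\<Sum>k\<in>{1..t-1}. ?w k) + ?w t) div ?P t) + 1"
      by (simp only: floor_divide_of_nat_eq)
    also have "((\<Sum>k\<in>{1..t-1}. ?w k) + ?w t) div ?P t = ix !\<^sub>1 t - 1"
    proof -
      have "(a + b * c) div c = b" if "a < c" for a b c :: nat using that by simp
      from this[OF less_P] show ?thesis .
    qed
    finally show ?thesis using pos by (simp add: of_nat_diff)
  qed
qed

text \<open>From right to left this is the digit extraction above. Conversely, once the higher
  values of \<open>pos_index\<close> are replaced by components of \<open>ix\<close>, the rule for
  component 1 is the definition of the linear index solved for its first term.\<close>

lemma at_position_iff:
  assumes ix: "ix \<in> indices ds" and ds: "ds \<noteq> []"
  shows "at_position ds i ix \<longleftrightarrow> linear_index ds ix = i"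
proof
  assume "linear_index ds ix = i"
  then show "at_position ds i ix"
    using pos_index_linear_index[OF assms] length_indices[OF ix] by (auto simp: at_position_iff_nth1)
next
  assume at: "at_position ds i ix"
  let ?P = "\<lambda>k. \<Prod>s\<in>{1..k-1}. ds !\<^sub>1 s"
  have eq: "int (ix !\<^sub>1 t) = pos_index ds i t" if "t \<in> {1..length ds}" for t
    using at that by (simp add: at_position_iff_nth1)
  have "(\<Sum>k\<in>{2..length ds}. (pos_index ds i k - 1) * int (?P k)) =
      int (\<Sum>k\<in>{2..length ds}. (ix !\<^sub>1 k - 1) * ?P k)"
    unfolding of_nat_sum
  proof (rule sum.cong[OF refl])
    fix k assume k: "k \<in> {2..length ds}"
    then have "1 \<le> ix !\<^sub>1 k" using indices_nth1_le(1)[OF ix, of k] by simp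
    then show "(pos_index ds i k - 1) * int (?P k) = int ((ix !\<^sub>1 k - 1) * ?P k)"
      using eq[of k] k by (simp add: of_nat_diff)
  qed
  moreover have "1 \<in> {1..length ds}" using ds by (cases ds) auto
  then have "int (ix !\<^sub>1 1) = pos_index ds i 1" by (rule eq)
  moreover have "pos_index ds i 1 = int i - (\<Sum>k\<in>{2..length ds}. (pos_index ds i k - 1) * int (?P k))"
    by (subst pos_index.simps) simp
  ultimately have "int (ix !\<^sub>1 1) = int i - int (\<Sum>k\<in>{2..length ds}. (ix !\<^sub>1 k - 1) * ?P k)"
    by linarith
  then have "int (linear_index ds ix) = int i"
    by (simp only: linear_index_def of_nat_add diff_add_cancel)
  then show "linear_index ds ix = i" by (simp only: of_nat_eq_iff)
qed

section \<open>Transfer of the matrix decomposition to tensors\<close>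

theorem theorem3p2:
  fixes N r :: nat and Is Js :: "nat list" and A :: "quat tensor"
  assumes "N \<ge> 1"
    and "length Is = N" and "length Js = N"
    and "\<forall>d\<in>set Is. d \<ge> 1" and "\<forall>d\<in>set Js. d \<ge> 1"
    and "dims A = Is @ Js"
    and "r = quat_rank (unfold_matrix N A)"
  shows "\<exists>(U :: quat tensor) (V :: quat tensor) (B :: real tensor) (d :: real list).
      unitary_tensor Is U \<and> unitary_tensor Js V \<and> dims B = Is @ Js \<and>
      A = U *\<^bsub>N\<^esub> map_tensor of_real B *\<^bsub>N\<^esub> ctranspose N V \<and>
      positive_singular_values (unfold_matrix N A) d \<and>
      (\<forall>is\<in>indices Is. \<forall>js\<in>indices Js.
         (\<forall>i\<in>{1..r}. at_position Is i is \<and> at_position Js i js \<longrightarrow> B $\<^sub>t (is @ js) = d !\<^sub>1 i) \<and>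
         (\<not> (\<exists>i\<in>{1..r}. at_position Is i is \<and> at_position Js i js) \<longrightarrow> B $\<^sub>t (is @ js) = 0))"
proof -
  have ne: "Is \<noteq> []" "Js \<noteq> []" using assms(1-3) by auto
  let ?A = "unfold_matrix N A" and ?m = "prod_list Is" and ?n = "prod_list Js"
  have cA: "?A \<in> carrier_mat ?m ?n" using unfold_matrix_carrier[OF assms(6,2)] .
  then have dim: "dim_row ?A = ?m" "dim_col ?A = ?n" by auto
  obtain d where d: "positive_singular_values ?A d" using quat_svd_exists by blast
  then have len: "length d = r" using assms(7) by (simp add: positive_singular_values_def)
  define B' :: "real mat" where
    "B' = Matrix.mat ?m ?n (\<lambda>(i, j). if i = j \<and> i < length d then d ! i else 0)"
  obtain U' V' where U': "unitary_quat_mat ?m U'" and V': "unitary_quat_mat ?n V'"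
    and eq: "?A = U' * Matrix.mat ?m ?n (\<lambda>(i, j). if i = j \<and> i < length d then of_real (d ! i) else 0)
        * mat_ctranspose V'"
    using d unfolding positive_singular_values_def dim by blast
  define U where "U = fold_tensor Is Is U'"
  define V where "V = fold_tensor Js Js V'"
  define B where "B = fold_tensor Is Js B'"
  have cB: "B' \<in> carrier_mat ?m ?n" by (simp add: B'_def)
  have cU: "U' \<in> carrier_mat ?m ?m" and cV: "V' \<in> carrier_mat ?n ?n"
    using U' V' by (simp_all add: unitary_quat_mat_def)
  have dimsB: "dims B = Is @ Js" and dimsU: "dims U = Is @ Is" and dimsV: "dims V = Js @ Js"
    by (simp_all add: B_def U_def V_def)
  let ?B = "map_tensor of_real B :: quat tensor"
  have dimsB': "dims ?B = Is @ Js" by (simp add: map_tensor_def dimsB)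
  have entry: "?B $\<^sub>t (is @ js) = of_real (B $\<^sub>t (is @ js))"
    if "is \<in> indices Is" "js \<in> indices Js" for "is" js
    using that by (simp add: map_tensor_def dimsB indices_append_iff length_indices)
  \<comment> \<open>The entrywise embedding of the reals commutes with unfolding, so the middle
    factor unfolds to the rectangular diagonal matrix.\<close>
  have "unfold_matrix N ?B = map_mat of_real (unfold_matrix N B)"
    using unfold_matrix_carrier[OF dimsB' assms(2)] unfold_matrix_carrier[OF dimsB assms(2)] ne
    by (intro eq_matI)
      (auto simp: unfold_matrix_nth[OF dimsB' assms(2)] unfold_matrix_nth[OF dimsB assms(2)]
        entry delin_in_indices)
  also have "\<dots> = Matrix.mat ?m ?n (\<lambda>(i, j). if i = j \<and> i < length d then of_real (d ! i) else 0)"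
    unfolding B_def unfold_fold_tensor[OF cB assms(2) ne] by (rule eq_matI) (auto simp: B'_def)
  finally have unfB: "unfold_matrix N ?B = \<dots>" .
  have dimsVt: "dims (ctranspose N V) = Js @ Js" by (rule dims_ctranspose[OF dimsV assms(3)])
  have dimsUB: "dims (U *\<^bsub>N\<^esub> ?B) = Is @ Js"
    by (rule dims_einstein_prod[OF dimsU dimsB' assms(2,2)])
  have A_eq: "A = U *\<^bsub>N\<^esub> ?B *\<^bsub>N\<^esub> ctranspose N V"
  proof (rule unfold_matrix_inject[OF assms(6) _ assms(2) ne])
    show "dims (U *\<^bsub>N\<^esub> ?B *\<^bsub>N\<^esub> ctranspose N V) = Is @ Js"
      by (rule dims_einstein_prod[OF dimsUB dimsVt assms(2,3)])
    show "?A = unfold_matrix N (U *\<^bsub>N\<^esub> ?B *\<^bsub>N\<^esub> ctranspose N V)"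
      unfolding unfold_einstein_prod[OF dimsUB dimsVt assms(2,3) ne ne(2)]
        unfold_einstein_prod[OF dimsU dimsB' assms(2,2) ne(1) ne]
        unfold_ctranspose[OF dimsV assms(3,3) ne(2,2)] unfB
      unfolding U_def V_def unfold_fold_tensor[OF cU assms(2) ne(1,1)]
        unfold_fold_tensor[OF cV assms(3) ne(2,2)]
      by (rule eq)
  qed
  have unitary: "unitary_tensor Is U" "unitary_tensor Js V"
    unfolding U_def V_def using U' V' ne by (simp_all add: unitary_fold_tensor)
  have entries: "\<forall>is\<in>indices Is. \<forall>js\<in>indices Js.
         (\<forall>i\<in>{1..r}. at_position Is i is \<and> at_position Js i js \<longrightarrow> B $\<^sub>t (is @ js) = d !\<^sub>1 i) \<and>
         (\<not> (\<exists>i\<in>{1..r}. at_position Is i is \<and> at_position Js i js) \<longrightarrow> B $\<^sub>t (is @ js) = 0)"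
  proof (intro ballI)
    fix "is" js assume ij: "is \<in> indices Is" "js \<in> indices Js"
    let ?a = "linear_index Is is" and ?b = "linear_index Js js"
    have range: "1 \<le> ?a" "?a \<le> ?m" "1 \<le> ?b" "?b \<le> ?n"
      using linear_index_range ne ij by blast+
    \<comment> \<open>Both linear indices are lowered by 1 in the matrix, so its diagonal is where
      they agree, and \<open>?a - 1 < length d\<close> becomes \<open>?a \<le> r\<close>.\<close>
    have "B $\<^sub>t (is @ js) = (if ?a = ?b \<and> ?a \<le> r then d !\<^sub>1 ?a else 0)"
      unfolding B_def fold_tensor_entry[OF ij] using range by (auto simp: B'_def len)
    then show "(\<forall>i\<in>{1..r}. at_position Is i is \<and> at_position Js i js \<longrightarrow> B $\<^sub>t (is @ js) = d !\<^sub>1 i) \<and>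
         (\<not> (\<exists>i\<in>{1..r}. at_position Is i is \<and> at_position Js i js) \<longrightarrow> B $\<^sub>t (is @ js) = 0)"
      \<comment> \<open>Being at position \<open>i\<close> means having linear index
        \<open>i\<close>, so the two conditions together say that \<open>?a\<close> and
        \<open>?b\<close> both equal \<open>i\<close>.\<close>
      using range by (simp add: at_position_iff[OF ij(1) ne(1)] at_position_iff[OF ij(2) ne(2)])
  qed
  show ?thesis
    by (rule exI[of _ U], rule exI[of _ V], rule exI[of _ B], rule exI[of _ d], intro conjI)
      (rule unitary dimsB A_eq d entries)+
qed

end
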